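(* Let $\mathcal{H}$ be a separable infinite-dimensional Hilbert space over $\mathbb{C}$ or $\mathbb{R}$ with a fixed orthonormal basis. The projections $p\in B(\mathcal{H})$ such that $E(p)=\mathrm{id}/2$ and $2p-\mathrm{id}$ is $2$-pavable are pathwise connected within the set of all projections with diagonal $\mathrm{id}/2$; that is, any two such projections can be joined by a norm-continuous path of projections $p'\in B(\mathcal{H})$ with $E(p')=\mathrm{id}/2$.
   Context: Diagonal operators are those whose matrix with respect to the fixed orthonormal basis is diagonal, and $E$ is the map from $B(\mathcal{H})$ onto the diagonal operators that keeps the diagonal entries and replaces all off-diagonal matrix entries by $0$. A projection is an operator $p=p^*=p^2$. An operator $x\in B(\mathcal{H})$ with $\|x\|=1$ is $2$-pavable if there exists a diagonal projection $e$ such that $\|exe\|<1$ and $\|e^\perp xe^\perp\|<1$, where $e^\perp=\mathrm{id}-e$. (For any projection $p$, $\|2p-\mathrm{id}\|=1$.) $B(\mathcal{H})$ carries the operator norm topology. *)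

theory Defs
  imports "HOL-Analysis.Analysis"
begin

text \<open>
  A Hilbert space over a scalar field with conjugation \<open>conj\<close>; it is used for the scalars
  \<open>(complex, cnj)\<close> and \<open>(real, id)\<close>.  The distribution has no complex inner product spaces, so
  scalar multiplication and inner product are parameters, compatible with the real Banach space
  structure of the carrier type: the operator norm of \<^typ>\<open>'h \<Rightarrow>\<^sub>L 'h\<close> is then the usual one.
  The inner product is linear in its first argument.
\<close>

locale scalar_hilbert_space = vector_space scale
  for scale :: "'k::real_normed_field \<Rightarrow> 'h::banach \<Rightarrow> 'h" +
  fixes conj :: "'k \<Rightarrow> 'k"
    and ip :: "'h \<Rightarrow> 'h \<Rightarrow> 'k"
  assumes conj_add: "conj (a + b) = conj a + conj b"
    and conj_mult: "conj (a * b) = conj a * conj b"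
    and mult_conj: "a * conj a = of_real ((norm a)\<^sup>2)"
    and scale_of_real: "scale (of_real r) x = r *\<^sub>R x"
    and ip_add_left: "ip (x + y) z = ip x z + ip y z"
    and ip_scale_left: "ip (scale c x) y = c * ip x y"
    and ip_commute: "ip y x = conj (ip x y)"
    and ip_self: "ip x x = of_real ((norm x)\<^sup>2)"
begin

text \<open>
  \<^typ>\<open>'h \<Rightarrow>\<^sub>L 'h\<close> consists of the bounded real-linear operators; \<open>B(H)\<close> is the closed subalgebra
  of those that are linear over the scalar field.
\<close>

definition bounded_operators :: "('h \<Rightarrow>\<^sub>L 'h) set" where
  "bounded_operators = {a. \<forall>c x. blinfun_apply a (scale c x) = scale c (blinfun_apply a x)}"

definition is_adjoint :: "('h \<Rightarrow>\<^sub>L 'h) \<Rightarrow> ('h \<Rightarrow>\<^sub>L 'h) \<Rightarrow> bool" where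
  "is_adjoint a a' \<longleftrightarrow> (\<forall>x y. ip (a x) y = ip x (a' y))"

definition projections :: "('h \<Rightarrow>\<^sub>L 'h) set" where
  "projections = {p \<in> bounded_operators. is_adjoint p p \<and> p o\<^sub>L p = p}"

end

locale hilbert_space_with_basis = scalar_hilbert_space scale conj ip
  for scale :: "'k::real_normed_field \<Rightarrow> 'h::banach \<Rightarrow> 'h"
    and conj :: "'k \<Rightarrow> 'k"
    and ip :: "'h \<Rightarrow> 'h \<Rightarrow> 'k" +
  fixes B :: "'h set"
  assumes orthonormal: "b \<in> B \<Longrightarrow> c \<in> B \<Longrightarrow> ip b c = (if b = c then 1 else 0)"
    and dense_span: "closure (span B) = UNIV"
begin

definition diagonal_operators :: "('h \<Rightarrow>\<^sub>L 'h) set" where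
  "diagonal_operators = {d \<in> bounded_operators. \<forall>b\<in>B. \<forall>c\<in>B. b \<noteq> c \<longrightarrow> ip (d b) c = 0}"

definition diagonal_part :: "('h \<Rightarrow>\<^sub>L 'h) \<Rightarrow> ('h \<Rightarrow>\<^sub>L 'h)" where
  "diagonal_part a = (THE d. d \<in> diagonal_operators \<and> (\<forall>b\<in>B. ip (d b) b = ip (a b) b))"

definition two_pavable :: "('h \<Rightarrow>\<^sub>L 'h) \<Rightarrow> bool" where
  "two_pavable x \<longleftrightarrow> x \<in> bounded_operators \<and> norm x = 1 \<and>
     (\<exists>e \<in> projections \<inter> diagonal_operators.
        norm (e o\<^sub>L x o\<^sub>L e) < 1 \<and>
        norm ((id_blinfun - e) o\<^sub>L x o\<^sub>L (id_blinfun - e)) < 1)"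

definition half_diagonal_projections :: "('h \<Rightarrow>\<^sub>L 'h) set" where
  "half_diagonal_projections = {p \<in> projections. diagonal_part p = (1/2) *\<^sub>R id_blinfun}"

end

locale separable_infinite_dimensional_hilbert_space = hilbert_space_with_basis scale conj ip B
  for scale :: "'k::real_normed_field \<Rightarrow> 'h::banach \<Rightarrow> 'h"
    and conj :: "'k \<Rightarrow> 'k"
    and ip :: "'h \<Rightarrow> 'h \<Rightarrow> 'k"
    and B :: "'h set" +
  assumes separable: "separable_space (euclidean :: 'h topology)"
    and infinite_dimensional: "\<not> (\<exists>S. finite S \<and> span S = UNIV)"

lemma scalar_hilbert_space_real:
  "scalar_hilbert_space scaleR (\<lambda>r::real. r) (inner :: 'g::{real_inner, banach} \<Rightarrow> 'g \<Rightarrow> real)"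
  by unfold_locales
     (auto simp: inner_add_left inner_add_right inner_commute dot_square_norm power2_eq_square scaleR_right_distrib scaleR_left_distrib)

text \<open>
  The remaining facts show that \<open>diagonal_part\<close> is well defined, i.e. its description has a
  unique solution for every operator.
\<close>

context scalar_hilbert_space begin

lemma conj_0 [simp]: "conj 0 = 0"
  using conj_add[of 0 0] by simp
lemma conj_sum: "conj (sum f A) = (\<Sum>a\<in>A. conj (f a))"
  by (induction A rule: infinite_finite_induct) (auto simp: conj_add)
lemma ip_0_left [simp]: "ip 0 y = 0"
  using ip_add_left[of 0 0 y] by simp
lemma ip_0_right [simp]: "ip y 0 = 0"
  using ip_commute[of y 0] by simp
lemma ip_add_right: "ip x (y + z) = ip x y + ip x z"
  by (metis conj_add ip_add_left ip_commute)
lemma ip_scale_right: "ip x (scale c y) = conj c * ip x y"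
  by (metis conj_mult ip_commute ip_scale_left)
lemma ip_minus_left: "ip (- x) y = - ip x y"
  using ip_add_left[of x "-x" y] by (simp add: minus_unique)
lemma ip_minus_right: "ip y (- x) = - ip y x"
  using ip_add_right[of y x "-x"] by (simp add: minus_unique)
lemma ip_diff_left: "ip (x - y) z = ip x z - ip y z"
  using ip_add_left[of x "-y" z] by (simp add: ip_minus_left)
lemma ip_diff_right: "ip z (x - y) = ip z x - ip z y"
  using ip_add_right[of z x "-y"] by (simp add: ip_minus_right)
lemma ip_sum_left: "ip (sum f A) y = (\<Sum>a\<in>A. ip (f a) y)"
  by (induction A rule: infinite_finite_induct) (auto simp: ip_add_left)
lemma ip_sum_right: "ip y (sum f A) = (\<Sum>a\<in>A. ip y (f a))"
  by (induction A rule: infinite_finite_induct) (auto simp: ip_add_right)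
lemma norm_scale: "norm (scale c x) = norm c * norm x"
proof -
  have "(of_real ((norm (scale c x))\<^sup>2) :: 'k) = of_real ((norm c * norm x)\<^sup>2)"
  proof -
    have "ip (scale c x) (scale c x) = (c * conj c) * ip x x"
      by (simp add: ip_scale_left ip_scale_right)
    then show ?thesis
      by (simp only: ip_self mult_conj power_mult_distrib of_real_mult)
  qed
  then have "(norm (scale c x))\<^sup>2 = (norm c * norm x)\<^sup>2"
    using of_real_eq_iff by blast
  then show ?thesis by (simp add: power2_eq_iff_nonneg)
qed
end

context hilbert_space_with_basis begin
lemma norm_lincomb: assumes "finite F" "F \<subseteq> B"
  shows "(norm (\<Sum>b\<in>F. scale (u b) b))\<^sup>2 = (\<Sum>b\<in>F. (norm (u b))\<^sup>2)"
proof -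
  have "(of_real ((norm (\<Sum>b\<in>F. scale (u b) b))\<^sup>2) :: 'k) = 
     (\<Sum>b\<in>F. \<Sum>c\<in>F. conj (u b) * (u c * ip c b))"
    by (simp add: ip_self[symmetric] ip_sum_left ip_sum_right ip_scale_left ip_scale_right sum_distrib_left
      del: of_real_power)
  also have "\<dots> = (\<Sum>b\<in>F. \<Sum>c\<in>F. if c = b then u b * conj (u b) else 0)"
    using assms by (intro sum.cong refl) (auto simp: orthonormal subset_iff)
  also have "\<dots> = (\<Sum>b\<in>F. u b * conj (u b))"
    using assms by simp
  also have "\<dots> = of_real (\<Sum>b\<in>F. (norm (u b))\<^sup>2)"
    by (simp only: mult_conj of_real_sum)
  finally show ?thesis using of_real_eq_iff by blast
qed

lemma bessel: assumes "finite F" "F \<subseteq> B"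
  shows "(\<Sum>b\<in>F. (norm (ip v b))\<^sup>2) \<le> (norm v)\<^sup>2"
proof -
  define w where "w = (\<Sum>b\<in>F. scale (ip v b) b)"
  have *: "ip v w = of_real (\<Sum>b\<in>F. (norm (ip v b))\<^sup>2)"
    unfolding w_def ip_sum_right ip_scale_right 
    by (simp only: mult.commute[of "conj _"] mult_conj of_real_sum)
  have **: "ip w v = of_real (\<Sum>b\<in>F. (norm (ip v b))\<^sup>2)"
  proof -
    have "ip w v = (\<Sum>b\<in>F. ip v b * conj (ip v b))"
      unfolding w_def ip_sum_left ip_scale_left
      by (intro sum.cong refl arg_cong2[where f="(*)"] ip_commute)
    then show ?thesis by (simp only: mult_conj of_real_sum)
  qed
  have ww: "(norm w)\<^sup>2 = (\<Sum>b\<in>F. (norm (ip v b))\<^sup>2)"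
    unfolding w_def using norm_lincomb[OF assms] .
  have "(of_real ((norm (v - w))\<^sup>2) :: 'k) = of_real ((norm v)\<^sup>2 - (norm w)\<^sup>2)"
    unfolding ip_self[symmetric] ip_diff_left ip_diff_right of_real_diff
    by (simp only: * ** ip_self ww diff_self) simp
  then have "(norm (v - w))\<^sup>2 = (norm v)\<^sup>2 - (norm w)\<^sup>2"
    using of_real_eq_iff by blast
  then show ?thesis using ww by (smt (verit) zero_le_power2)
qed

lemma basis_orthogonal_zero: assumes "\<And>b. b \<in> B \<Longrightarrow> ip w b = 0" shows "w = 0"
proof (rule ccontr)
  assume "w \<noteq> 0"
  then obtain s where s: "s \<in> span B" "dist s w < norm w"
    using dense_span closure_approachable[of w "span B"] by (metis UNIV_I zero_less_norm_iff)
  have ws: "ip w s = 0"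
    using s(1) by (induction rule: span_induct_alt) (auto simp: ip_add_right ip_scale_right assms)
  then have sw: "ip s w = 0"
    using ip_commute[of s w] by simp
  have "(of_real ((norm (s - w))\<^sup>2) :: 'k) = of_real ((norm s)\<^sup>2 + (norm w)\<^sup>2)"
    unfolding ip_self[symmetric] ip_diff_left ip_diff_right of_real_add ws sw
    by simp
  then have "(norm (s - w))\<^sup>2 = (norm s)\<^sup>2 + (norm w)\<^sup>2"
    using of_real_eq_iff by blast
  moreover have "(norm (s - w))\<^sup>2 < (norm w)\<^sup>2"
    using s(2) by (intro power_strict_mono) (auto simp: dist_norm)
  ultimately show False by (smt (verit) zero_le_power2)
qed

lemma operator_eqI:
  assumes d: "d \<in> bounded_operators" "d' \<in> bounded_operators"
    and eq: "\<And>b c. b \<in> B \<Longrightarrow> c \<in> B \<Longrightarrow> ip (blinfun_apply d b) c = ip (blinfun_apply d' b) c"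
  shows "d = d'"
proof (rule blinfun_eqI)
  fix x
  have basis: "blinfun_apply d b = blinfun_apply d' b" if "b \<in> B" for b
    using basis_orthogonal_zero[of "blinfun_apply d b - blinfun_apply d' b"] eq that
    by (auto simp: ip_diff_left)
  have span: "blinfun_apply d s = blinfun_apply d' s" if "s \<in> span B" for s
    using that
    by (induction rule: span_induct_alt)
       (use d in \<open>auto simp: blinfun.bilinear_simps bounded_operators_def basis\<close>)
  have "closed {s. blinfun_apply d s = blinfun_apply d' s}"
    by (intro closed_Collect_eq continuous_intros)
  then have "closure (span B) \<subseteq> {s. blinfun_apply d s = blinfun_apply d' s}"
    by (intro closure_minimal) (auto simp: span)
  then show "blinfun_apply d x = blinfun_apply d' x"
    by (auto simp: dense_span)
qed

lemma norm_ip_basis_le: "b \<in> B \<Longrightarrow> norm (ip v b) \<le> norm v"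
  using bessel[of "{b}" v] by (simp add: power2_le_iff_abs_le)

lemma summable_expansion:
  assumes l: "\<And>b. b \<in> B \<Longrightarrow> norm (l b) \<le> M"
  shows "(\<lambda>b. scale (l b * ip v b) b) summable_on B"
proof -
  have M: "(norm (\<Sum>b\<in>F. scale (l b * ip v b) b))\<^sup>2 \<le> M\<^sup>2 * (\<Sum>b\<in>F. (norm (ip v b))\<^sup>2)"
    if "finite F" "F \<subseteq> B" for F
    unfolding norm_lincomb[OF that] sum_distrib_left
    by (intro sum_mono) (use that l in \<open>auto simp: norm_mult power_mult_distrib intro!: mult_right_mono power_mono\<close>)
  have "(\<lambda>b. (norm (ip v b))\<^sup>2) summable_on B"
    by (intro nonneg_bdd_above_summable_on bdd_aboveI2[where M="(norm v)\<^sup>2"]) (auto intro: bessel)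
  then have S: "((\<lambda>F. \<Sum>b\<in>F. (norm (ip v b))\<^sup>2) \<longlongrightarrow> (\<Sum>\<^sub>\<infinity>b\<in>B. (norm (ip v b))\<^sup>2)) (finite_subsets_at_top B)"
    by (rule infsum_tendsto)
  have "cauchy_filter (filtermap (sum (\<lambda>b. scale (l b * ip v b) b)) (finite_subsets_at_top B))"
    unfolding cauchy_filter_metric_filtermap
  proof (intro allI impI)
    fix e :: real assume e: "e > 0"
    define e' where "e' = e\<^sup>2 / (4 * (M\<^sup>2 + 1))"
    have e': "e' > 0" unfolding e'_def using e by (auto intro!: divide_pos_pos add_nonneg_pos)
    define T where "T = (\<Sum>\<^sub>\<infinity>b\<in>B. (norm (ip v b))\<^sup>2)"
    obtain F0 where F0: "finite F0" "F0 \<subseteq> B"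
      "\<And>F. finite F \<Longrightarrow> F0 \<subseteq> F \<Longrightarrow> F \<subseteq> B \<Longrightarrow> dist (\<Sum>b\<in>F. (norm (ip v b))\<^sup>2) T < e' / 2"
      using tendstoD[OF S, of "e'/2"] e' unfolding eventually_finite_subsets_at_top T_def by auto
    have close: "norm (sum (\<lambda>b. scale (l b * ip v b) b) F - sum (\<lambda>b. scale (l b * ip v b) b) F0) < e / 2"
      if F: "finite F" "F0 \<subseteq> F" "F \<subseteq> B" for F
    proof -
      have "(norm (sum (\<lambda>b. scale (l b * ip v b) b) (F - F0)))\<^sup>2 \<le> M\<^sup>2 * (\<Sum>b\<in>F - F0. (norm (ip v b))\<^sup>2)"
        using F by (intro M) auto
      also have "\<dots> \<le> M\<^sup>2 * e'"
      proof (intro mult_left_mono)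
        have "(\<Sum>b\<in>F - F0. (norm (ip v b))\<^sup>2) = (\<Sum>b\<in>F. (norm (ip v b))\<^sup>2) - (\<Sum>b\<in>F0. (norm (ip v b))\<^sup>2)"
          using F by (simp add: sum_diff)
        also have "\<dots> \<le> e'"
          using F0(3)[OF F] F0(3)[OF F0(1) subset_refl F0(2)] unfolding dist_real_def by linarith
        finally show "(\<Sum>b\<in>F - F0. (norm (ip v b))\<^sup>2) \<le> e'" .
      qed simp
      also have "\<dots> < (M\<^sup>2 + 1) * e'"
        using e' by (simp add: distrib_right)
      also have "\<dots> = (e / 2)\<^sup>2"
      proof -
        have "M\<^sup>2 + 1 \<noteq> 0" by (smt (verit) zero_le_power2)
        then show ?thesis unfolding e'_def by (simp add: power_divide divide_simps) (simp add: algebra_simps)?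
      qed
      finally have "norm (sum (\<lambda>b. scale (l b * ip v b) b) (F - F0)) < e / 2"
        by (rule power2_less_imp_less) (use e in simp)
      then show ?thesis using F F0(1) by (simp add: sum_diff)
    qed
    show "\<exists>P. eventually P (finite_subsets_at_top B) \<and>
      (\<forall>x y. P x \<and> P y \<longrightarrow> dist (sum (\<lambda>b. scale (l b * ip v b) b) x) (sum (\<lambda>b. scale (l b * ip v b) b) y) < e)"
    proof (intro exI[of _ "\<lambda>F. finite F \<and> F0 \<subseteq> F \<and> F \<subseteq> B"] conjI allI impI)
      show "eventually (\<lambda>F. finite F \<and> F0 \<subseteq> F \<and> F \<subseteq> B) (finite_subsets_at_top B)"
        unfolding eventually_finite_subsets_at_top using F0 by auto
    qed (use close in \<open>smt (verit) dist_norm dist_triangle_half_l dist_commute\<close>)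
  qed
  then show ?thesis
    using cauchy_filter_complete_converges[of "filtermap (sum (\<lambda>b. scale (l b * ip v b) b)) (finite_subsets_at_top B)" UNIV]
    unfolding summable_on_def has_sum_def filterlim_def
    by (auto simp: complete_UNIV filtermap_bot_iff)
qed

lemma diagonal_operator_exists:
  assumes l: "\<And>b. b \<in> B \<Longrightarrow> norm (l b) \<le> M"
  shows "\<exists>d \<in> bounded_operators. \<forall>b\<in>B. blinfun_apply d b = scale (l b) b"
proof -
  define f where "f v = (\<Sum>\<^sub>\<infinity>b\<in>B. scale (l b * ip v b) b)" for v
  note summ = summable_expansion[of l M, OF l]
  have f_add: "f (v + w) = f v + f w" for v w
    unfolding f_def by (simp add: ip_add_left distrib_left scale_left_distrib infsum_add summ)
  have bl: "bounded_linear (scale c)" for c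
  proof (rule bounded_linear_intro[where K="norm c"])
    fix r x show "scale c (r *\<^sub>R x) = r *\<^sub>R scale c x"
      by (simp add: scale_of_real[symmetric] scale_left_commute)
  qed (auto simp: scale_right_distrib norm_scale mult.commute)
  have f_scale: "f (scale c v) = scale c (f v)" for c v
  proof -
    have "f (scale c v) = (\<Sum>\<^sub>\<infinity>b\<in>B. scale c (scale (l b * ip v b) b))"
      unfolding f_def by (simp add: ip_scale_left mult.left_commute)
    also have "\<dots> = scale c (f v)"
      unfolding f_def
      using has_sum_bounded_linear[OF bl has_sum_infsum[OF summ]] by (rule infsumI)
    finally show ?thesis .
  qed
  have M0: "norm (f v) \<le> norm v * \<bar>M\<bar>" for v
  proof -
    have *: "((\<lambda>F. norm (\<Sum>b\<in>F. scale (l b * ip v b) b)) \<longlongrightarrow> norm (f v)) (finite_subsets_at_top B)"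
      unfolding f_def by (intro tendsto_norm infsum_tendsto summ)
    show ?thesis
    proof (rule tendsto_upperbound[OF *])
      show "\<forall>\<^sub>F F in finite_subsets_at_top B. norm (\<Sum>b\<in>F. scale (l b * ip v b) b) \<le> norm v * \<bar>M\<bar>"
      proof (rule eventually_finite_subsets_at_top_weakI)
        fix F assume F: "finite F" "F \<subseteq> B"
        have "(norm (\<Sum>b\<in>F. scale (l b * ip v b) b))\<^sup>2 \<le> M\<^sup>2 * (\<Sum>b\<in>F. (norm (ip v b))\<^sup>2)"
          unfolding norm_lincomb[OF F] sum_distrib_left
          by (intro sum_mono) (use F l in \<open>auto simp: norm_mult power_mult_distrib intro!: mult_right_mono power_mono\<close>)
        also have "\<dots> \<le> M\<^sup>2 * (norm v)\<^sup>2"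
          by (intro mult_left_mono bessel F) auto
        also have "\<dots> = (norm v * \<bar>M\<bar>)\<^sup>2" by (simp add: power_mult_distrib)
        finally show "norm (\<Sum>b\<in>F. scale (l b * ip v b) b) \<le> norm v * \<bar>M\<bar>"
          by (rule power2_le_imp_le) auto
      qed
    qed auto
  qed
  have "bounded_linear f"
    using f_add f_scale[of "of_real _"] M0 by (intro bounded_linear_intro) (auto simp: scale_of_real)
  then have app: "blinfun_apply (Blinfun f) = f" by (rule bounded_linear_Blinfun_apply)
  have "f b = scale (l b) b" if "b \<in> B" for b
    unfolding f_def
    by (rule infsumI, rule has_sum_finite_neutralI[of "{b}"]) (use that in \<open>auto simp: orthonormal\<close>)
  then show ?thesis
    by (intro bexI[of _ "Blinfun f"]) (auto simp: app bounded_operators_def f_scale)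
qed

lemma diagonal_part:
  "diagonal_part a \<in> diagonal_operators"
  "b \<in> B \<Longrightarrow> ip (blinfun_apply (diagonal_part a) b) b = ip (blinfun_apply a b) b"
proof -
  have "norm (ip (blinfun_apply a b) b) \<le> norm a" if "b \<in> B" for b
  proof -
    have "norm b = 1"
      using that orthonormal[OF that that] ip_self[of b]
      by (metis norm_one norm_of_real abs_power2 norm_ge_zero power2_eq_1_iff abs_norm_cancel abs_minus abs_one)
    then show ?thesis
      using norm_ip_basis_le[OF that, of "blinfun_apply a b"] norm_blinfun[of a b] by simp
  qed
  from diagonal_operator_exists[of "\<lambda>b. ip (blinfun_apply a b) b" "norm a", OF this] obtain d
    where d: "d \<in> bounded_operators" "\<forall>b\<in>B. blinfun_apply d b = scale (ip (blinfun_apply a b) b) b"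
    by blast
  have "\<exists>!d. d \<in> diagonal_operators \<and> (\<forall>b\<in>B. ip (blinfun_apply d b) b = ip (blinfun_apply a b) b)"
  proof (rule ex_ex1I)
    show "\<exists>d. d \<in> diagonal_operators \<and> (\<forall>b\<in>B. ip (blinfun_apply d b) b = ip (blinfun_apply a b) b)"
      using d by (intro exI[of _ d]) (auto simp: diagonal_operators_def ip_scale_left orthonormal)
    fix d d'
    assume "d \<in> diagonal_operators \<and> (\<forall>b\<in>B. ip (blinfun_apply d b) b = ip (blinfun_apply a b) b)"
      "d' \<in> diagonal_operators \<and> (\<forall>b\<in>B. ip (blinfun_apply d' b) b = ip (blinfun_apply a b) b)"
    then show "d = d'"
      unfolding diagonal_operators_def by (intro operator_eqI) (auto, metis)
  qed
  from theI'[OF this] show "diagonal_part a \<in> diagonal_operators"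
    "b \<in> B \<Longrightarrow> ip (blinfun_apply (diagonal_part a) b) b = ip (blinfun_apply a b) b"
    unfolding diagonal_part_def by auto
qed

end

end

theory Submission
  imports Defs
begin

text \<open>
  With \<open>x = 2 p - 1\<close> one works with self-adjoint unitaries (symmetries) \<open>x\<close> of diagonal \<open>0\<close>.  If the
  diagonal projection \<open>e\<close> paves \<open>x\<close>, the part \<open>\<alpha>\<close> of \<open>x\<close> commuting with \<open>e\<close> has norm \<open>< 1\<close>, and shrinking
  it to \<open>0\<close> while rescaling the rest by \<open>sqrt (1 - t\<^sup>2 \<alpha>\<^sup>2)\<close> joins \<open>x\<close> to a symmetry \<open>u\<close> that is
  off-diagonal with respect to \<open>e\<close>.  All such \<open>u\<close> are conjugate under the unitary group of the
  infinite-dimensional corner \<open>1 - e\<close>, and an elementary Kuiper-type argument (make the unitary fix an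
  infinite-dimensional subspace, then swindle) writes every element of that group as a product of
  90 degree rotations; this works over the reals as well, where no logarithm is available.  Finally,
  a symmetry permuting the basis can be off-diagonal for two diagonal projections at once, which links
  any \<open>e\<close> to any \<open>f\<close> through a third projection cutting both of them into infinite pieces.
\<close>

text \<open>Unlike the library's infix, this one binds more tightly than addition.\<close>

abbreviation operator_compose (infixl "\<odot>" 70) where
  "a \<odot> b \<equiv> blinfun_compose a b"

lemma operator_compose_simps [simp]:
  "a \<odot> id_blinfun = a" "id_blinfun \<odot> a = a" "a \<odot> 0 = 0" "0 \<odot> a = 0"
  by (auto intro!: blinfun_eqI)

lemma operator_compose_assoc: "a \<odot> b \<odot> c = a \<odot> (b \<odot> c)"
  by (rule blinfun_eqI) simp

lemma operator_compose_distribs: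
  "a \<odot> (b + c) = a \<odot> b + a \<odot> c" "(b + c) \<odot> a = b \<odot> a + c \<odot> a"
  "a \<odot> (b - c) = a \<odot> b - a \<odot> c" "(b - c) \<odot> a = b \<odot> a - c \<odot> a"
  "a \<odot> (r *\<^sub>R b) = r *\<^sub>R (a \<odot> b)" "(r *\<^sub>R b) \<odot> a = r *\<^sub>R (b \<odot> a)"
  by (auto intro!: blinfun_eqI simp: blinfun.bilinear_simps)

lemma compose_eqD: "a \<odot> b = c \<Longrightarrow> blinfun_apply a (blinfun_apply b x) = blinfun_apply c x"
  by auto

context scalar_hilbert_space begin

lemma conj_1 [simp]: "conj 1 = 1"
  using mult_conj[of 1] by simp

lemma norm_conj [simp]: "norm (conj a) = norm a"
proof (cases "a = 0")
  case False
  have "norm (a * conj a) = (norm a)\<^sup>2" by (subst mult_conj) (simp only: norm_of_real abs_power2)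
  then show ?thesis using False by (simp add: norm_mult power2_eq_square)
qed simp

lemma ip_scaleR_left: "ip (r *\<^sub>R x) y = r *\<^sub>R ip x y"
  by (simp add: scale_of_real[symmetric] ip_scale_left scaleR_conv_of_real)

lemma ip_scaleR_right: "ip x (r *\<^sub>R y) = r *\<^sub>R ip x y"
proof -
  have "(of_real r :: 'k) * conj (of_real r) = of_real r * of_real r"
    by (subst mult_conj) (simp only: norm_of_real power2_abs power2_eq_square of_real_mult abs_mult_self_eq)
  then have "conj (of_real r) = of_real r"
    by (cases "r = 0") auto
  then show ?thesis
    by (simp add: scale_of_real[symmetric] ip_scale_right scaleR_conv_of_real)
qed

definition orthonormal_family :: "'i set \<Rightarrow> ('i \<Rightarrow> 'h) \<Rightarrow> bool" where
  "orthonormal_family I f \<longleftrightarrow> (\<forall>i\<in>I. \<forall>j\<in>I. ip (f i) (f j) = (if i = j then 1 else 0))"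

lemma orthonormal_familyD:
  "orthonormal_family I f \<Longrightarrow> i \<in> I \<Longrightarrow> j \<in> I \<Longrightarrow> ip (f i) (f j) = (if i = j then 1 else 0)"
  by (auto simp: orthonormal_family_def)

lemma norm_lincomb_family:
  assumes f: "orthonormal_family I f" and F: "finite F" "F \<subseteq> I"
  shows "(norm (\<Sum>i\<in>F. scale (u i) (f i)))\<^sup>2 = (\<Sum>i\<in>F. (norm (u i))\<^sup>2)"
proof -
  have "(of_real ((norm (\<Sum>i\<in>F. scale (u i) (f i)))\<^sup>2) :: 'k) =
      (\<Sum>i\<in>F. \<Sum>j\<in>F. conj (u i) * (u j * ip (f j) (f i)))"
    by (simp add: ip_self[symmetric] ip_sum_left ip_sum_right ip_scale_left ip_scale_right
        sum_distrib_left del: of_real_power)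
  also have "\<dots> = (\<Sum>i\<in>F. \<Sum>j\<in>F. if j = i then u i * conj (u i) else 0)"
    using F by (intro sum.cong refl) (auto simp: orthonormal_familyD[OF f] subset_iff)
  also have "\<dots> = of_real (\<Sum>i\<in>F. (norm (u i))\<^sup>2)"
    using F by (simp add: mult_conj)
  finally show ?thesis using of_real_eq_iff by blast
qed

lemma bessel_family:
  assumes f: "orthonormal_family I f" and F: "finite F" "F \<subseteq> I"
  shows "(\<Sum>i\<in>F. (norm (ip v (f i)))\<^sup>2) \<le> (norm v)\<^sup>2"
proof -
  define w where "w = (\<Sum>i\<in>F. scale (ip v (f i)) (f i))"
  have vw: "ip v w = of_real (\<Sum>i\<in>F. (norm (ip v (f i)))\<^sup>2)"
    unfolding w_def ip_sum_right ip_scale_right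
    by (simp only: mult.commute[of "conj _"] mult_conj of_real_sum)
  have wv: "ip w v = of_real (\<Sum>i\<in>F. (norm (ip v (f i)))\<^sup>2)"
  proof -
    have "ip w v = (\<Sum>i\<in>F. ip v (f i) * conj (ip v (f i)))"
      unfolding w_def ip_sum_left ip_scale_left
      by (intro sum.cong refl arg_cong2[where f="(*)"] ip_commute)
    then show ?thesis by (simp only: mult_conj of_real_sum)
  qed
  have ww: "(norm w)\<^sup>2 = (\<Sum>i\<in>F. (norm (ip v (f i)))\<^sup>2)"
    unfolding w_def using norm_lincomb_family[OF f F] .
  have "(of_real ((norm (v - w))\<^sup>2) :: 'k) = of_real ((norm v)\<^sup>2 - (norm w)\<^sup>2)"
    unfolding ip_self[symmetric] ip_diff_left ip_diff_right of_real_diff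
    by (simp only: vw wv ip_self ww diff_self) simp
  then have "(norm (v - w))\<^sup>2 = (norm v)\<^sup>2 - (norm w)\<^sup>2"
    using of_real_eq_iff by blast
  then show ?thesis using ww by (smt (verit) zero_le_power2)
qed

lemma ip_scaleR_normalize: "y \<noteq> 0 \<Longrightarrow> ip (y /\<^sub>R norm y) (y /\<^sub>R norm y) = 1"
  unfolding ip_self by simp

lemma cauchy_schwarz: "norm (ip x y) \<le> norm x * norm y"
proof (cases "y = 0")
  case False
  have "orthonormal_family {()} (\<lambda>_. y /\<^sub>R norm y)"
    using ip_scaleR_normalize[OF False] by (simp add: orthonormal_family_def)
  from bessel_family[OF this, of "{()}" x]
  have "(norm (ip x y) / norm y)\<^sup>2 \<le> (norm x)\<^sup>2"
    by (simp add: ip_scaleR_right divide_inverse mult.commute)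
  then have "norm (ip x y) / norm y \<le> norm x"
    by (rule power2_le_imp_le) simp
  then show ?thesis using False by (simp add: divide_simps)
qed simp

lemma bounded_bilinear_ip: "bounded_bilinear ip"
proof (rule bounded_bilinear.intro)
  show "\<exists>K. \<forall>x y. norm (ip x y) \<le> norm x * norm y * K"
    by (intro exI[of _ 1]) (simp add: cauchy_schwarz)
qed (auto simp: ip_add_left ip_add_right ip_scaleR_left ip_scaleR_right)

lemmas continuous_on_ip [continuous_intros] =
  bounded_bilinear.continuous_on[OF bounded_bilinear_ip]

lemma bounded_linear_ip_left: "bounded_linear (\<lambda>x. ip x y)"
  by (rule bounded_bilinear.bounded_linear_left[OF bounded_bilinear_ip])

lemma bounded_linear_scale: "bounded_linear (scale c)"
proof (rule bounded_linear_intro[where K="norm c"])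
  fix r x show "scale c (r *\<^sub>R x) = r *\<^sub>R scale c x"
    by (simp add: scale_of_real[symmetric] scale_left_commute)
qed (auto simp: scale_right_distrib norm_scale mult.commute)

lemmas continuous_on_scale [continuous_intros] =
  bounded_linear.continuous_on[OF bounded_linear_scale]

lemma ip_eq_0_all: "(\<And>y. ip x y = 0) \<Longrightarrow> x = 0"
  using ip_self[of x] by simp

lemma ip_eqI: "(\<And>y. ip x y = ip x' y) \<Longrightarrow> x = x'"
  using ip_eq_0_all[of "x - x'"] by (simp add: ip_diff_left)

lemma ip_eqI_right: "(\<And>y. ip y x = ip y x') \<Longrightarrow> x = x'"
  by (rule ip_eqI) (metis ip_commute)

lemma ip_sym_0: "ip x y = 0 \<Longrightarrow> ip y x = 0"
  by (metis ip_commute conj_0)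

lemma pythagoras: "ip x y = 0 \<Longrightarrow> (norm (x + y))\<^sup>2 = (norm x)\<^sup>2 + (norm y)\<^sup>2"
proof -
  assume xy: "ip x y = 0"
  have "(of_real ((norm (x + y))\<^sup>2) :: 'k) = of_real ((norm x)\<^sup>2 + (norm y)\<^sup>2)"
    unfolding of_real_add ip_self[symmetric] ip_add_left ip_add_right xy ip_sym_0[OF xy] by simp
  then show ?thesis using of_real_eq_iff by blast
qed

lemma summable_orthonormal_family:
  assumes f: "orthonormal_family I f"
    and M: "\<And>F. finite F \<Longrightarrow> F \<subseteq> I \<Longrightarrow> (\<Sum>i\<in>F. (norm (c i))\<^sup>2) \<le> M"
  shows "(\<lambda>i. scale (c i) (f i)) summable_on I"
    and "(norm (\<Sum>\<^sub>\<infinity>i\<in>I. scale (c i) (f i)))\<^sup>2 \<le> M"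
proof -
  let ?g = "\<lambda>i. scale (c i) (f i)"
  have "(\<lambda>i. (norm (c i))\<^sup>2) summable_on I"
    by (intro nonneg_bdd_above_summable_on bdd_aboveI2[where M=M]) (auto intro: M)
  then have S: "((\<lambda>F. \<Sum>i\<in>F. (norm (c i))\<^sup>2) \<longlongrightarrow> (\<Sum>\<^sub>\<infinity>i\<in>I. (norm (c i))\<^sup>2))
      (finite_subsets_at_top I)"
    by (rule infsum_tendsto)
  have "cauchy_filter (filtermap (sum ?g) (finite_subsets_at_top I))"
    unfolding cauchy_filter_metric_filtermap
  proof (intro allI impI)
    fix e :: real assume e: "e > 0"
    define T where "T = (\<Sum>\<^sub>\<infinity>i\<in>I. (norm (c i))\<^sup>2)"
    obtain F0 where F0: "finite F0" "F0 \<subseteq> I"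
      "\<And>F. finite F \<Longrightarrow> F0 \<subseteq> F \<Longrightarrow> F \<subseteq> I \<Longrightarrow> dist (\<Sum>i\<in>F. (norm (c i))\<^sup>2) T < (e/2)\<^sup>2 / 2"
      using tendstoD[OF S, of "(e/2)\<^sup>2/2"] e unfolding eventually_finite_subsets_at_top T_def by auto
    have close: "norm (sum ?g F - sum ?g F0) < e / 2" if F: "finite F" "F0 \<subseteq> F" "F \<subseteq> I" for F
    proof -
      have "(norm (sum ?g (F - F0)))\<^sup>2 = (\<Sum>i\<in>F - F0. (norm (c i))\<^sup>2)"
        using F by (intro norm_lincomb_family[OF f]) auto
      also have "\<dots> = (\<Sum>i\<in>F. (norm (c i))\<^sup>2) - (\<Sum>i\<in>F0. (norm (c i))\<^sup>2)"
        using F by (simp add: sum_diff)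
      also have "\<dots> < (e / 2)\<^sup>2"
        using F0(3)[OF F] F0(3)[OF F0(1) subset_refl F0(2)] unfolding dist_real_def by linarith
      finally have "norm (sum ?g (F - F0)) < e / 2"
        by (rule power2_less_imp_less) (use e in simp)
      then show ?thesis using F F0(1) by (simp add: sum_diff)
    qed
    show "\<exists>P. eventually P (finite_subsets_at_top I) \<and>
      (\<forall>x y. P x \<and> P y \<longrightarrow> dist (sum ?g x) (sum ?g y) < e)"
    proof (intro exI[of _ "\<lambda>F. finite F \<and> F0 \<subseteq> F \<and> F \<subseteq> I"] conjI allI impI)
      show "eventually (\<lambda>F. finite F \<and> F0 \<subseteq> F \<and> F \<subseteq> I) (finite_subsets_at_top I)"
        unfolding eventually_finite_subsets_at_top using F0 by auto
    qed (use close in \<open>smt (verit) dist_norm dist_triangle_half_l dist_commute\<close>)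
  qed
  then show summ: "?g summable_on I"
    using cauchy_filter_complete_converges[of "filtermap (sum ?g) (finite_subsets_at_top I)" UNIV]
    unfolding summable_on_def has_sum_def filterlim_def
    by (auto simp: complete_UNIV filtermap_bot_iff)
  have "((\<lambda>F. (norm (sum ?g F))\<^sup>2) \<longlongrightarrow> (norm (\<Sum>\<^sub>\<infinity>i\<in>I. ?g i))\<^sup>2) (finite_subsets_at_top I)"
    by (intro tendsto_intros infsum_tendsto summ)
  then show "(norm (\<Sum>\<^sub>\<infinity>i\<in>I. ?g i))\<^sup>2 \<le> M"
    by (rule tendsto_upperbound)
       (auto intro!: eventually_finite_subsets_at_top_weakI simp: norm_lincomb_family[OF f] M)
qed

section \<open>Operators and adjoints\<close>

lemma bounded_operators_scale:
  "a \<in> bounded_operators \<Longrightarrow> blinfun_apply a (scale c x) = scale c (blinfun_apply a x)"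
  by (simp add: bounded_operators_def)

lemma scale_scaleR: "scale c (r *\<^sub>R x) = r *\<^sub>R scale c x"
  by (simp add: scale_of_real[symmetric] scale_left_commute)

lemma bounded_operators_intros [intro, simp]:
  "id_blinfun \<in> bounded_operators"
  "0 \<in> bounded_operators"
  "a \<in> bounded_operators \<Longrightarrow> b \<in> bounded_operators \<Longrightarrow> a + b \<in> bounded_operators"
  "a \<in> bounded_operators \<Longrightarrow> b \<in> bounded_operators \<Longrightarrow> a - b \<in> bounded_operators"
  "a \<in> bounded_operators \<Longrightarrow> b \<in> bounded_operators \<Longrightarrow> a \<odot> b \<in> bounded_operators"
  "a \<in> bounded_operators \<Longrightarrow> - a \<in> bounded_operators"
  "a \<in> bounded_operators \<Longrightarrow> r *\<^sub>R a \<in> bounded_operators"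
  by (auto simp: bounded_operators_def blinfun.bilinear_simps scale_right_distrib
      scale_right_diff_distrib scale_scaleR)

lemma closed_bounded_operators: "closed bounded_operators"
  unfolding bounded_operators_def
  by (intro closed_Collect_all closed_Collect_eq continuous_intros)

end

context hilbert_space_with_basis begin

lemma orthonormal_family_basis: "orthonormal_family B (\<lambda>b. b)"
  by (auto simp: orthonormal_family_def orthonormal)

lemma operator_of_coefficients:
  assumes f: "orthonormal_family B f"
    and add: "\<And>x y b. l (x + y) b = l x b + l y b"
    and scale: "\<And>c x b. l (scale c x) b = c * l x b"
    and bound: "\<And>F x. finite F \<Longrightarrow> F \<subseteq> B \<Longrightarrow> (\<Sum>b\<in>F. (norm (l x b))\<^sup>2) \<le> (norm x * M)\<^sup>2"
    and M: "M \<ge> 0"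
  shows "\<exists>T \<in> bounded_operators. \<forall>x. blinfun_apply T x = (\<Sum>\<^sub>\<infinity>b\<in>B. scale (l x b) (f b)) \<and>
    (\<forall>b\<in>B. ip (blinfun_apply T x) (f b) = l x b)"
proof -
  define t where "t x = (\<Sum>\<^sub>\<infinity>b\<in>B. scale (l x b) (f b))" for x
  note summ = summable_orthonormal_family(1)[OF f bound]
  have t_add: "t (x + y) = t x + t y" for x y
    unfolding t_def by (simp add: add scale_left_distrib infsum_add summ)
  note sums = has_sum_infsum[OF summ, folded t_def]
  have t_scale: "t (scale c x) = scale c (t x)" for c x
    using infsumI[OF has_sum_bounded_linear[OF bounded_linear_scale[of c] sums[of x]]]
    by (simp add: t_def scale)
  have "norm (t x) \<le> norm x * M" for x
    using summable_orthonormal_family(2)[OF f bound[of _ x]] M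
    unfolding t_def by (auto intro: power2_le_imp_le)
  then have "bounded_linear t"
    using t_add t_scale[of "of_real _"] by (intro bounded_linear_intro) (auto simp: scale_of_real)
  then have app: "blinfun_apply (Blinfun t) = t" by (rule bounded_linear_Blinfun_apply)
  have "ip (t x) (f b) = l x b" if b: "b \<in> B" for x b
  proof -
    have "ip (t x) (f b) = (\<Sum>\<^sub>\<infinity>c\<in>B. ip (scale (l x c) (f c)) (f b))"
      by (rule infsumI[OF has_sum_bounded_linear[OF bounded_linear_ip_left sums], symmetric])
    also have "\<dots> = l x b"
      by (rule infsumI, rule has_sum_finite_neutralI[of "{b}"])
         (use b in \<open>auto simp: ip_scale_left orthonormal_familyD[OF f]\<close>)
    finally show ?thesis .
  qed
  then show ?thesis
    by (intro bexI[of _ "Blinfun t"]) (auto simp: app t_def[symmetric] bounded_operators_def t_scale)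
qed

lemma isometry_exists:
  assumes f: "orthonormal_family B f"
  shows "\<exists>T \<in> bounded_operators. \<forall>b\<in>B. blinfun_apply T b = f b"
proof -
  obtain T where T: "T \<in> bounded_operators"
      "\<And>x. blinfun_apply T x = (\<Sum>\<^sub>\<infinity>b\<in>B. scale (ip x b) (f b))"
    using operator_of_coefficients[OF f, of ip 1]
    by (auto simp: ip_add_left ip_scale_left bessel)
  have "blinfun_apply T b = f b" if "b \<in> B" for b
    unfolding T
    by (rule infsumI, rule has_sum_finite_neutralI[of "{b}"]) (use that in \<open>auto simp: orthonormal\<close>)
  then show ?thesis using T by blast
qed

lemma basis_density:
  assumes "closed {x. P x}" "P 0" "\<And>b. b \<in> B \<Longrightarrow> P b"
    and "\<And>x y. P x \<Longrightarrow> P y \<Longrightarrow> P (x + y)" "\<And>c x. P x \<Longrightarrow> P (scale c x)"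
  shows "P x"
proof -
  have "P s" if "s \<in> span B" for s
    using that by (induction rule: span_induct_alt) (use assms in auto)
  then have "closure (span B) \<subseteq> {x. P x}"
    using assms(1) by (intro closure_minimal) auto
  then show ?thesis by (auto simp: dense_span)
qed

lemma adjoint_exists:
  assumes a: "a \<in> bounded_operators"
  shows "\<exists>a' \<in> bounded_operators. is_adjoint a a'"
proof -
  have bound: "(\<Sum>b\<in>F. (norm (ip x (blinfun_apply a b)))\<^sup>2) \<le> (norm x * norm a)\<^sup>2"
    if F: "finite F" "F \<subseteq> B" for F x
  proof -
    define z where "z = (\<Sum>b\<in>F. scale (ip x (blinfun_apply a b)) b)"
    have z: "(norm z)\<^sup>2 = (\<Sum>b\<in>F. (norm (ip x (blinfun_apply a b)))\<^sup>2)"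
      unfolding z_def using norm_lincomb[OF F] .
    have "ip x (blinfun_apply a z) =
        (\<Sum>b\<in>F. ip x (blinfun_apply a b) * conj (ip x (blinfun_apply a b)))"
      by (simp add: z_def blinfun.sum_right ip_sum_right bounded_operators_scale[OF a] ip_scale_right
          mult.commute)
    also have "\<dots> = of_real ((norm z)\<^sup>2)"
      unfolding z by (simp only: mult_conj of_real_sum)
    finally have "norm (of_real ((norm z)\<^sup>2) :: 'k) \<le> norm x * norm (blinfun_apply a z)"
      using cauchy_schwarz by metis
    also have "\<dots> \<le> norm x * (norm a * norm z)"
      by (intro mult_left_mono norm_blinfun) auto
    finally have "norm z * norm z \<le> (norm x * norm a) * norm z"
      by (simp only: norm_of_real abs_power2 power2_eq_square mult.assoc)
    then have "norm z \<le> norm x * norm a"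
      using mult_right_le_imp_le[of "norm z" "norm z"] by (cases "z = 0") auto
    then show ?thesis unfolding z[symmetric] by (intro power_mono) auto
  qed
  obtain T where T: "T \<in> bounded_operators"
      "\<And>x b. b \<in> B \<Longrightarrow> ip (blinfun_apply T x) b = ip x (blinfun_apply a b)"
    using operator_of_coefficients[OF orthonormal_family_basis,
        of "\<lambda>x b. ip x (blinfun_apply a b)" "norm a"] bound
    by (simp add: ip_add_left ip_scale_left) blast
  have "ip (blinfun_apply a z) x = ip z (blinfun_apply T x)" for x z
  proof (rule basis_density[where x=z])
    show "closed {z. ip (blinfun_apply a z) x = ip z (blinfun_apply T x)}"
      by (intro closed_Collect_eq continuous_intros)
    show "ip (blinfun_apply a b) x = ip b (blinfun_apply T x)" if "b \<in> B" for b
      using T(2)[OF that] ip_commute by metis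
  qed (auto simp: blinfun.bilinear_simps ip_add_left ip_scale_left bounded_operators_scale[OF a])
  then show ?thesis using T(1) by (auto simp: is_adjoint_def)
qed

definition adj :: "('h \<Rightarrow>\<^sub>L 'h) \<Rightarrow> ('h \<Rightarrow>\<^sub>L 'h)" where
  "adj a = (SOME a'. a' \<in> bounded_operators \<and> is_adjoint a a')"

lemma adj_someI:
  assumes "a \<in> bounded_operators"
  shows "adj a \<in> bounded_operators \<and> is_adjoint a (adj a)"
  unfolding adj_def by (rule someI_ex) (use adjoint_exists[OF assms] in blast)

lemma adj_closed [intro, simp]: "a \<in> bounded_operators \<Longrightarrow> adj a \<in> bounded_operators"
  using adj_someI by blast

lemma adj_right: "a \<in> bounded_operators \<Longrightarrow> ip (blinfun_apply a x) y = ip x (blinfun_apply (adj a) y)"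
  using adj_someI by (auto simp: is_adjoint_def)

lemma adj_left: "a \<in> bounded_operators \<Longrightarrow> ip x (blinfun_apply a y) = ip (blinfun_apply (adj a) x) y"
  using adj_right ip_commute by metis

lemma adj_eqI:
  assumes "a \<in> bounded_operators" "is_adjoint a a'"
  shows "adj a = a'"
  by (rule blinfun_eqI, rule ip_eqI_right)
     (use assms adj_right[OF assms(1)] in \<open>simp add: is_adjoint_def\<close>)

lemma adj_adj [simp]: "a \<in> bounded_operators \<Longrightarrow> adj (adj a) = a"
  by (intro adj_eqI) (auto simp: is_adjoint_def adj_left)

lemma adj_id [simp]: "adj id_blinfun = id_blinfun"
  by (intro adj_eqI) (auto simp: is_adjoint_def)

lemma adj_comp [simp]:
  "a \<in> bounded_operators \<Longrightarrow> b \<in> bounded_operators \<Longrightarrow> adj (a \<odot> b) = adj b \<odot> adj a"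
  by (intro adj_eqI) (auto simp: is_adjoint_def adj_right)

lemma adj_linear [simp]:
  "a \<in> bounded_operators \<Longrightarrow> b \<in> bounded_operators \<Longrightarrow> adj (a + b) = adj a + adj b"
  "a \<in> bounded_operators \<Longrightarrow> b \<in> bounded_operators \<Longrightarrow> adj (a - b) = adj a - adj b"
  "a \<in> bounded_operators \<Longrightarrow> adj (- a) = - adj a"
  "a \<in> bounded_operators \<Longrightarrow> adj (r *\<^sub>R a) = r *\<^sub>R adj a"
  by (auto intro!: adj_eqI simp: is_adjoint_def adj_right blinfun.bilinear_simps
      ip_add_left ip_add_right ip_diff_left ip_diff_right ip_minus_left ip_minus_right
      ip_scaleR_left ip_scaleR_right)

lemma adj_0 [simp]: "adj 0 = 0"
  by (intro adj_eqI) (auto simp: is_adjoint_def)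

lemma operator_eq_on_basis:
  assumes d: "d \<in> bounded_operators" "d' \<in> bounded_operators"
    and eq: "\<And>b. b \<in> B \<Longrightarrow> blinfun_apply d b = blinfun_apply d' b"
  shows "d = d'"
  by (rule operator_eqI[OF d]) (simp add: eq)

lemma isometry_adj:
  assumes T: "T \<in> bounded_operators" and f: "orthonormal_family B (blinfun_apply T)"
  shows "adj T \<odot> T = id_blinfun"
  by (rule operator_eqI)
     (use T in \<open>auto simp: adj_left[symmetric] orthonormal_familyD[OF f] orthonormal\<close>)


definition unitaries :: "('h \<Rightarrow>\<^sub>L 'h) set" where
  "unitaries = {g \<in> bounded_operators. adj g \<odot> g = id_blinfun \<and> g \<odot> adj g = id_blinfun}"

definition symmetries :: "('h \<Rightarrow>\<^sub>L 'h) set" where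
  "symmetries = {x \<in> bounded_operators. adj x = x \<and> x \<odot> x = id_blinfun}"

definition corner_unitaries :: "('h \<Rightarrow>\<^sub>L 'h) \<Rightarrow> ('h \<Rightarrow>\<^sub>L 'h) set" where
  "corner_unitaries e = {g \<in> unitaries. g \<odot> e = e \<and> e \<odot> g = e}"

definition corner_rotors :: "('h \<Rightarrow>\<^sub>L 'h) \<Rightarrow> ('h \<Rightarrow>\<^sub>L 'h) set" where
  "corner_rotors e = {J \<in> bounded_operators. adj J = - J \<and> J \<odot> (J \<odot> J) = - J \<and>
     J \<odot> e = 0 \<and> e \<odot> J = 0}"

text \<open>\<open>rotation J t\<close> is the exponential of \<open>t J\<close> whenever \<open>J\<^sup>3 = - J\<close>.\<close>

definition rotation :: "('h \<Rightarrow>\<^sub>L 'h) \<Rightarrow> real \<Rightarrow> ('h \<Rightarrow>\<^sub>L 'h)" where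
  "rotation J t = id_blinfun + sin t *\<^sub>R J + (1 - cos t) *\<^sub>R (J \<odot> J)"

inductive_set rotation_group :: "('h \<Rightarrow>\<^sub>L 'h) \<Rightarrow> ('h \<Rightarrow>\<^sub>L 'h) set" for e where
  id: "id_blinfun \<in> rotation_group e"
| step: "J \<in> corner_rotors e \<Longrightarrow> g \<in> rotation_group e \<Longrightarrow>
    rotation J (pi/2) \<odot> g \<in> rotation_group e"

lemma unitariesD:
  assumes "g \<in> unitaries"
  shows "g \<in> bounded_operators" "blinfun_apply (adj g) (blinfun_apply g x) = x"
    "blinfun_apply g (blinfun_apply (adj g) x) = x"
  using assms by (auto simp: unitaries_def dest: compose_eqD)

lemma unitariesI:
  assumes "g \<in> bounded_operators" "\<And>x. blinfun_apply (adj g) (blinfun_apply g x) = x"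
    "\<And>x. blinfun_apply g (blinfun_apply (adj g) x) = x"
  shows "g \<in> unitaries"
  using assms by (auto simp: unitaries_def intro!: blinfun_eqI)

lemma corner_unitariesD:
  assumes "g \<in> corner_unitaries e"
  shows "g \<in> unitaries" "g \<in> bounded_operators"
    "blinfun_apply (adj g) (blinfun_apply g x) = x"
    "blinfun_apply g (blinfun_apply (adj g) x) = x"
    "blinfun_apply g (blinfun_apply e x) = blinfun_apply e x"
    "blinfun_apply e (blinfun_apply g x) = blinfun_apply e x"
    "blinfun_apply (adj g) (blinfun_apply e x) = blinfun_apply e x"
    "blinfun_apply e (blinfun_apply (adj g) x) = blinfun_apply e x"
proof -
  show g: "g \<in> unitaries" and ge: "\<And>x. blinfun_apply g (blinfun_apply e x) = blinfun_apply e x"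
    and eg: "\<And>x. blinfun_apply e (blinfun_apply g x) = blinfun_apply e x"
    using assms by (auto simp: corner_unitaries_def dest: compose_eqD)
  show "g \<in> bounded_operators" "blinfun_apply (adj g) (blinfun_apply g x) = x"
    "blinfun_apply g (blinfun_apply (adj g) x) = x"
    using unitariesD[OF g] by auto
  show "blinfun_apply (adj g) (blinfun_apply e x) = blinfun_apply e x"
    by (metis ge unitariesD(2)[OF g])
  show "blinfun_apply e (blinfun_apply (adj g) x) = blinfun_apply e x"
    by (metis eg unitariesD(3)[OF g])
qed

lemma corner_unitariesI:
  assumes "g \<in> unitaries" "\<And>x. blinfun_apply g (blinfun_apply e x) = blinfun_apply e x"
    "\<And>x. blinfun_apply e (blinfun_apply g x) = blinfun_apply e x"
  shows "g \<in> corner_unitaries e"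
  using assms by (auto simp: corner_unitaries_def intro!: blinfun_eqI)

lemma unitaries_adj [intro]: "g \<in> unitaries \<Longrightarrow> adj g \<in> unitaries"
  by (auto simp: unitaries_def)

lemma corner_unitaries_adj [intro]: "g \<in> corner_unitaries e \<Longrightarrow> adj g \<in> corner_unitaries e"
  by (rule corner_unitariesI) (auto simp: corner_unitariesD)

lemma corner_unitaries_comp [intro]:
  "g \<in> corner_unitaries e \<Longrightarrow> h \<in> corner_unitaries e \<Longrightarrow> g \<odot> h \<in> corner_unitaries e"
  by (rule corner_unitariesI, rule unitariesI) (auto simp: corner_unitariesD)

lemma corner_rotorsD:
  assumes "J \<in> corner_rotors e"
  shows "J \<in> bounded_operators" "adj J = - J"
    "blinfun_apply J (blinfun_apply J (blinfun_apply J x)) = - blinfun_apply J x"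
    "blinfun_apply J (blinfun_apply e x) = 0" "blinfun_apply e (blinfun_apply J x) = 0"
proof -
  show "J \<in> bounded_operators" "adj J = - J" using assms by (auto simp: corner_rotors_def)
  have "J \<odot> (J \<odot> J) = - J" "J \<odot> e = 0" "e \<odot> J = 0"
    using assms by (auto simp: corner_rotors_def)
  from this[THEN compose_eqD]
  show "blinfun_apply J (blinfun_apply J (blinfun_apply J x)) = - blinfun_apply J x"
    "blinfun_apply J (blinfun_apply e x) = 0" "blinfun_apply e (blinfun_apply J x) = 0"
    by (auto simp: blinfun.bilinear_simps)
qed

lemma corner_rotorsI:
  assumes "J \<in> bounded_operators" "adj J = - J"
    "\<And>x. blinfun_apply J (blinfun_apply J (blinfun_apply J x)) = - blinfun_apply J x"
    "\<And>x. blinfun_apply J (blinfun_apply e x) = 0" "\<And>x. blinfun_apply e (blinfun_apply J x) = 0"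
  shows "J \<in> corner_rotors e"
  using assms by (auto simp: corner_rotors_def blinfun.bilinear_simps intro!: blinfun_eqI)

lemma corner_rotors_uminus: "J \<in> corner_rotors e \<Longrightarrow> - J \<in> corner_rotors e"
  by (rule corner_rotorsI) (auto simp: corner_rotorsD blinfun.bilinear_simps)

lemma rotation_closed [simp]: "J \<in> bounded_operators \<Longrightarrow> rotation J t \<in> bounded_operators"
  by (simp add: rotation_def)

lemma adj_rotation:
  assumes "J \<in> corner_rotors e"
  shows "adj (rotation J t) = rotation J (- t)"
proof -
  have "(- J) \<odot> (- J) = J \<odot> J" by (rule blinfun_eqI) (simp add: blinfun.bilinear_simps)
  then show ?thesis using corner_rotorsD(1,2)[OF assms] by (simp add: rotation_def)
qed

lemma rotation_inverse:
  assumes J: "J \<in> corner_rotors e"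
  shows "blinfun_apply (rotation J (- t)) (blinfun_apply (rotation J t) x) = x"
proof -
  note J' = corner_rotorsD(3)[OF J]
  let ?c = "cos t" and ?s = "sin t"
  have "(?c * ?c) *\<^sub>R y + (?s * ?s) *\<^sub>R y = y" for y :: 'h
    by (simp flip: scaleR_left_distrib)
  note this [simp]
  show ?thesis
    by (simp add: rotation_def blinfun.bilinear_simps J' algebra_simps)
qed

lemma rotation_corner_unitary:
  assumes J: "J \<in> corner_rotors e"
  shows "rotation J t \<in> corner_unitaries e"
proof (rule corner_unitariesI)
  show "rotation J t \<in> unitaries"
    using corner_rotorsD(1)[OF J] rotation_inverse[OF J, of t] rotation_inverse[OF J, of "- t"]
    by (intro unitariesI) (auto simp: adj_rotation[OF J])
qed (simp_all add: rotation_def corner_rotorsD[OF J] blinfun.bilinear_simps)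

lemma rotation_group_corner_unitary: "g \<in> rotation_group e \<Longrightarrow> g \<in> corner_unitaries e"
proof (induction rule: rotation_group.induct)
  case id
  show ?case by (rule corner_unitariesI, rule unitariesI) auto
qed (auto intro: rotation_corner_unitary)

lemma rotation_group_gen: "J \<in> corner_rotors e \<Longrightarrow> rotation J (pi/2) \<in> rotation_group e"
  using rotation_group.step[OF _ rotation_group.id] by fastforce

lemma rotation_group_comp:
  "g \<in> rotation_group e \<Longrightarrow> h \<in> rotation_group e \<Longrightarrow> g \<odot> h \<in> rotation_group e"
  by (induction rule: rotation_group.induct)
     (auto simp: operator_compose_assoc intro: rotation_group.step)

lemma rotation_group_adj:
  assumes "g \<in> rotation_group e"
  shows "adj g \<in> rotation_group e"
  using assms
proof (induction rule: rotation_group.induct)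
  case (step J g)
  have "adj (rotation J (pi/2)) = rotation (- J) (pi/2)"
    unfolding adj_rotation[OF step(1)] by (rule blinfun_eqI) (simp add: rotation_def blinfun.bilinear_simps)
  then have "adj (rotation J (pi/2)) \<in> rotation_group e"
    using rotation_group_gen[OF corner_rotors_uminus[OF step(1)]] by simp
  then show ?case
    using step corner_rotorsD(1)[OF step(1)] rotation_group_corner_unitary[OF step(2)]
    by (simp add: corner_unitariesD rotation_group_comp)
qed (simp add: rotation_group.id)

lemma rotation_group_conj:
  assumes "k \<in> rotation_group e" "g \<in> corner_unitaries e"
  shows "g \<odot> k \<odot> adj g \<in> rotation_group e"
  using assms(1)
proof (induction rule: rotation_group.induct)
  case id
  show ?case using assms(2) rotation_group.id by (auto simp: corner_unitaries_def unitaries_def)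
next
  case (step J h)
  note g = corner_unitariesD[OF assms(2)] and J = corner_rotorsD[OF step(1)]
  have J': "g \<odot> J \<odot> adj g \<in> corner_rotors e"
    using g J by (intro corner_rotorsI) (auto simp: blinfun.bilinear_simps operator_compose_assoc
        bounded_bilinear.minus_left[OF bounded_bilinear_blinfun_compose]
        bounded_bilinear.minus_right[OF bounded_bilinear_blinfun_compose])
  have "g \<odot> (rotation J (pi/2) \<odot> h) \<odot> adj g =
      rotation (g \<odot> J \<odot> adj g) (pi/2) \<odot> (g \<odot> h \<odot> adj g)"
    by (rule blinfun_eqI) (simp add: rotation_def blinfun.bilinear_simps g)
  then show ?case using step J' by (simp add: rotation_group.step)
qed

section \<open>Moving isometries by rotations\<close>

lemma projectionsD:
  assumes "e \<in> projections"
  shows "e \<in> bounded_operators" "adj e = e"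
    "blinfun_apply e (blinfun_apply e x) = blinfun_apply e x"
  using assms by (auto simp: projections_def intro: adj_eqI dest: compose_eqD)

lemma rotation_moves:
  assumes e: "e \<in> projections" and C: "C \<in> bounded_operators" and D: "D \<in> bounded_operators"
    and Cr: "adj C \<odot> C = r" "C \<odot> r = C" and Dr: "adj D \<odot> D = r" "D \<odot> r = D"
    and CD: "adj C \<odot> D = 0" and eC: "e \<odot> C = 0" and eD: "e \<odot> D = 0"
  shows "\<exists>k \<in> rotation_group e. k \<odot> C = D"
proof -
  define J where "J = D \<odot> adj C - C \<odot> adj D"
  have DC: "adj D \<odot> C = 0"
    using adj_comp[of "adj C" D] CD C D by simp
  have Ce: "adj C \<odot> e = 0" "adj D \<odot> e = 0"
    using adj_comp[of e C] adj_comp[of e D] eC eD C D projectionsD(1,2)[OF e] by simp_all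
  have "adj r = r" using Cr(1) adj_comp[of "adj C" C] C by simp
  then have "r \<odot> adj C = adj C" "r \<odot> adj D = adj D"
    using adj_comp[of C r] adj_comp[of D r] Cr Dr C D by auto
  note pt' = this[THEN compose_eqD]
  note pt = Cr[THEN compose_eqD] Dr[THEN compose_eqD] CD[THEN compose_eqD] DC[THEN compose_eqD]
    eC[THEN compose_eqD] eD[THEN compose_eqD] Ce[THEN compose_eqD] pt'
  have J: "J \<in> corner_rotors e"
    using C D unfolding J_def
    by (intro corner_rotorsI) (auto simp: blinfun.bilinear_simps pt)
  have "rotation J (pi/2) \<odot> C = D"
    by (rule blinfun_eqI) (simp add: rotation_def J_def blinfun.bilinear_simps pt)
  then show ?thesis using rotation_group_gen[OF J] by blast
qed

definition dilation :: "('h \<Rightarrow>\<^sub>L 'h) \<Rightarrow> ('h \<Rightarrow>\<^sub>L 'h) \<Rightarrow> ('h \<Rightarrow>\<^sub>L 'h)" where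
  "dilation C X = C \<odot> X \<odot> adj C + (id_blinfun - C \<odot> adj C)"

definition corner_isometries :: "('h \<Rightarrow>\<^sub>L 'h) \<Rightarrow> ('h \<Rightarrow>\<^sub>L 'h) set" where
  "corner_isometries e = {C \<in> bounded_operators. adj C \<odot> C = id_blinfun \<and> e \<odot> C = 0}"

lemma corner_isometriesD:
  assumes "C \<in> corner_isometries e"
  shows "C \<in> bounded_operators" "adj C \<odot> C = id_blinfun" "e \<odot> C = 0"
    "blinfun_apply (adj C) (blinfun_apply C x) = x" "blinfun_apply e (blinfun_apply C x) = 0"
  using assms by (auto simp: corner_isometries_def dest: compose_eqD)

lemma corner_isometries_comp:
  assumes "C \<in> corner_isometries e" "s \<in> bounded_operators" "adj s \<odot> s = id_blinfun"
  shows "C \<odot> s \<in> corner_isometries e"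
  using corner_isometriesD[OF assms(1)] assms(2) assms(3)[THEN compose_eqD]
  by (auto simp: corner_isometries_def intro!: blinfun_eqI)

lemma corner_adj_0:
  assumes e: "e \<in> projections" and C: "C \<in> bounded_operators" "e \<odot> C = 0"
  shows "adj C \<odot> e = 0"
  using adj_comp[of e C] C projectionsD(1,2)[OF e] by simp

lemma dilation_corner_unitary:
  assumes e: "e \<in> projections" and C: "C \<in> corner_isometries e" and X: "X \<in> unitaries"
  shows "dilation C X \<in> corner_unitaries e"
proof -
  note C' = corner_isometriesD[OF C] and X' = unitariesD[OF X]
  note Ce = corner_adj_0[OF e C'(1,3), THEN compose_eqD]
  have "dilation C X \<in> bounded_operators" using C' X' by (simp add: dilation_def)
  moreover have "adj (dilation C X) = dilation C (adj X)"
    using C' X' by (simp add: dilation_def operator_compose_assoc)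
  ultimately show ?thesis
    by (intro corner_unitariesI unitariesI)
       (simp_all add: dilation_def blinfun.bilinear_simps C' X' Ce)
qed

lemma dilation_move:
  assumes e: "e \<in> projections" and C: "C \<in> corner_isometries e" and D: "D \<in> corner_isometries e"
    and CD: "adj C \<odot> D = 0" and X: "X \<in> unitaries"
  shows "\<exists>n \<in> rotation_group e. dilation D X = n \<odot> dilation C X"
proof -
  note C' = corner_isometriesD[OF C] and D' = corner_isometriesD[OF D]
  obtain k where k: "k \<in> rotation_group e" "k \<odot> C = D"
    using rotation_moves[OF e C'(1) D'(1) C'(2) _ D'(2) _ CD C'(3) D'(3)] by auto
  note k' = corner_unitariesD[OF rotation_group_corner_unitary[OF k(1)]]
  note g = dilation_corner_unitary[OF e C X]
  have "dilation D X = k \<odot> dilation C X \<odot> adj k"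
    by (rule blinfun_eqI)
       (simp add: dilation_def blinfun.bilinear_simps k' C' flip: k(2))
  also have "\<dots> = (k \<odot> (dilation C X \<odot> adj k \<odot> adj (dilation C X))) \<odot> dilation C X"
    by (rule blinfun_eqI) (simp add: corner_unitariesD[OF g])
  finally show ?thesis
    using rotation_group_comp[OF k(1) rotation_group_conj[OF rotation_group_adj[OF k(1)] g]] by blast
qed

text \<open>
  An Eilenberg swindle: modulo rotations the class of \<open>dilation C X\<close> does not depend on \<open>C\<close> and is
  multiplicative in \<open>X\<close>, so the fixed point equation for \<open>Y\<close> makes the class of \<open>X\<close> trivial.
\<close>

lemma swindle:
  assumes e: "e \<in> projections" and A: "A \<in> corner_isometries e"
    and s: "s \<in> bounded_operators" "adj s \<odot> s = id_blinfun"
    and t: "t \<in> bounded_operators" "adj t \<odot> t = id_blinfun"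
    and st: "adj s \<odot> t = 0" "s \<odot> adj s + t \<odot> adj t = id_blinfun"
    and X: "X \<in> unitaries" and Y: "Y \<in> unitaries" and fixed: "Y = s \<odot> X \<odot> adj s + t \<odot> Y \<odot> adj t"
  shows "dilation (A \<odot> t \<odot> s) X \<in> rotation_group e"
proof -
  note A' = corner_isometriesD[OF A]
  have ts: "adj t \<odot> s = 0"
    using adj_comp[of "adj s" t] st(1) s t by simp
  note pt = s(2)[THEN compose_eqD] t(2)[THEN compose_eqD] st(1)[THEN compose_eqD] ts[THEN compose_eqD]
  define a where "a = A \<odot> s"
  define b where "b = A \<odot> t"
  have iso: "a \<in> corner_isometries e" "b \<in> corner_isometries e"
      "b \<odot> s \<in> corner_isometries e" "b \<odot> t \<in> corner_isometries e"
    unfolding a_def b_def by (intro corner_isometries_comp A s t)+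
  have "adj a \<odot> b = 0" "adj a \<odot> (b \<odot> t) = 0"
    using A' s t by (auto intro!: blinfun_eqI simp: a_def b_def pt)
  then obtain m n where m: "m \<in> rotation_group e" "dilation b Y = m \<odot> dilation a Y"
    and n: "n \<in> rotation_group e" "dilation (b \<odot> t) Y = n \<odot> dilation a Y"
    using dilation_move[OF e iso(1,2) _ Y] dilation_move[OF e iso(1,4) _ Y] by blast
  define D where "D = dilation (b \<odot> s) X"
  have "dilation b (s \<odot> X \<odot> adj s + t \<odot> Y \<odot> adj t) = D \<odot> dilation (b \<odot> t) Y"
  proof (rule blinfun_eqI)
    fix z
    have "blinfun_apply b w = blinfun_apply b (blinfun_apply s (blinfun_apply (adj s) w)) +
      blinfun_apply b (blinfun_apply t (blinfun_apply (adj t) w))" for w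
      using st(2) by (metis blinfun.add_left blinfun.add_right blinfun_apply_blinfun_compose
          blinfun_apply_id_blinfun id_apply)
    from this[of "blinfun_apply (adj b) z"]
    show "blinfun_apply (dilation b (s \<odot> X \<odot> adj s + t \<odot> Y \<odot> adj t)) z =
        blinfun_apply (D \<odot> dilation (b \<odot> t) Y) z"
      using s t corner_isometriesD[OF iso(2)]
      by (simp add: D_def dilation_def blinfun.bilinear_simps pt algebra_simps)
  qed
  with fixed have "m \<odot> dilation a Y = D \<odot> (n \<odot> dilation a Y)"
    using m(2) n(2) by simp
  then have eq: "blinfun_apply m (blinfun_apply (dilation a Y) z) =
      blinfun_apply D (blinfun_apply n (blinfun_apply (dilation a Y) z))" for z
    by (metis blinfun_apply_blinfun_compose)
  note g = corner_unitariesD[OF dilation_corner_unitary[OF e iso(1) Y]]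
  have mn: "blinfun_apply m z = blinfun_apply D (blinfun_apply n z)" for z
    using eq[of "blinfun_apply (adj (dilation a Y)) z"] by (simp add: g)
  have "D = m \<odot> adj n"
    by (rule blinfun_eqI) (simp add: mn corner_unitariesD[OF rotation_group_corner_unitary[OF n(1)]])
  then show ?thesis
    using rotation_group_comp[OF m(1) rotation_group_adj[OF n(1)]] by (simp add: D_def b_def)
qed

section \<open>Paths of symmetries\<close>

definition offdiagonal_symmetries :: "('h \<Rightarrow>\<^sub>L 'h) \<Rightarrow> ('h \<Rightarrow>\<^sub>L 'h) set" where
  "offdiagonal_symmetries e = {x \<in> symmetries. x \<odot> e + e \<odot> x = x}"

lemma symmetriesD:
  assumes "x \<in> symmetries"
  shows "x \<in> bounded_operators" "adj x = x" "blinfun_apply x (blinfun_apply x v) = v"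
  using assms by (auto simp: symmetries_def dest: compose_eqD)

lemma offdiagonal_symmetriesD:
  assumes "x \<in> offdiagonal_symmetries e"
  shows "x \<in> symmetries" "x \<in> bounded_operators" "adj x = x" "blinfun_apply x (blinfun_apply x v) = v"
    "blinfun_apply e (blinfun_apply x v) = blinfun_apply x v - blinfun_apply x (blinfun_apply e v)"
proof -
  show x: "x \<in> symmetries" using assms by (auto simp: offdiagonal_symmetries_def)
  show "x \<in> bounded_operators" "adj x = x" "blinfun_apply x (blinfun_apply x v) = v"
    using symmetriesD[OF x] by auto
  have "x \<odot> e + e \<odot> x = x" using assms by (auto simp: offdiagonal_symmetries_def)
  from arg_cong[OF this, of "\<lambda>a. blinfun_apply a v"]
  show "blinfun_apply e (blinfun_apply x v) = blinfun_apply x v - blinfun_apply x (blinfun_apply e v)"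
    by (simp add: blinfun.bilinear_simps algebra_simps)
qed

lemma offdiagonal_conj:
  assumes g: "g \<in> corner_unitaries e" and x: "x \<in> offdiagonal_symmetries e"
  shows "g \<odot> x \<odot> adj g \<in> offdiagonal_symmetries e"
proof -
  note g' = corner_unitariesD[OF g] and x' = offdiagonal_symmetriesD[OF x]
  have "g \<odot> x \<odot> adj g \<in> symmetries"
    using g' x' by (auto simp: symmetries_def operator_compose_assoc intro!: blinfun_eqI)
  moreover have "blinfun_apply g (blinfun_apply x (blinfun_apply e v)) + 
     blinfun_apply e (blinfun_apply x (blinfun_apply (adj g) v)) = 
     blinfun_apply g (blinfun_apply x (blinfun_apply (adj g) v))" for v
  proof -
    define w where "w = blinfun_apply (adj g) v"
    have w: "blinfun_apply e v = blinfun_apply e w" by (simp add: w_def g')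
    have "blinfun_apply e (blinfun_apply x w) = blinfun_apply g (blinfun_apply e (blinfun_apply x w))"
      by (simp only: g'(5))
    also have "\<dots> = blinfun_apply g (blinfun_apply x w) - blinfun_apply g (blinfun_apply x (blinfun_apply e w))"
      by (simp only: x'(5) blinfun.diff_right)
    finally show ?thesis by (simp add: w flip: w_def)
  qed
  ultimately show ?thesis
    by (auto simp: offdiagonal_symmetries_def blinfun.bilinear_simps g' intro!: blinfun_eqI)
qed

lemma path_component_rotation_group:
  assumes "g \<in> rotation_group e" and x: "x \<in> offdiagonal_symmetries e"
  shows "path_component (offdiagonal_symmetries e) x (g \<odot> x \<odot> adj g)"
  using assms(1)
proof (induction rule: rotation_group.induct)
  case id
  show ?case using x by (simp add: path_component_refl)
next
  case (step J g)
  define u where "u = g \<odot> x \<odot> adj g"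
  have u: "u \<in> offdiagonal_symmetries e"
    unfolding u_def using offdiagonal_conj[OF rotation_group_corner_unitary[OF step(2)] x] .
  define R where "R t = rotation J (t * (pi/2)) \<odot> u \<odot> rotation J (- (t * (pi/2)))" for t :: real
  have Ru: "R t \<in> offdiagonal_symmetries e" for t
    using offdiagonal_conj[OF rotation_corner_unitary[OF step(1)] u, of "t * (pi/2)"]
    by (simp add: adj_rotation[OF step(1)] R_def)
  have "path R"
    unfolding path_def R_def rotation_def by (intro continuous_intros)
  moreover have "path_image R \<subseteq> offdiagonal_symmetries e"
    using Ru by (auto simp: path_image_def)
  moreover have "pathstart R = u"
    by (auto simp: pathstart_def R_def rotation_def)
  moreover have "pathfinish R = (rotation J (pi/2) \<odot> g) \<odot> x \<odot> adj (rotation J (pi/2) \<odot> g)"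
    using corner_rotorsD(1)[OF step(1)] corner_unitariesD(2)[OF rotation_group_corner_unitary[OF step(2)]]
    by (simp add: pathfinish_def R_def adj_rotation[OF step(1)] u_def operator_compose_assoc)
  ultimately have "path_component (offdiagonal_symmetries e) u
      ((rotation J (pi/2) \<odot> g) \<odot> x \<odot> adj (rotation J (pi/2) \<odot> g))"
    unfolding path_component_def by blast
  then show ?case using step.IH path_component_trans unfolding u_def by blast
qed

end

context scalar_hilbert_space begin

lemma orthonormal_family_comp:
  "orthonormal_family J f \<Longrightarrow> inj_on \<pi> I \<Longrightarrow> \<pi> ` I \<subseteq> J \<Longrightarrow> orthonormal_family I (\<lambda>i. f (\<pi> i))"
  unfolding orthonormal_family_def by (auto simp: inj_on_def image_subset_iff)

lemma unit_vector_orthogonal: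
  "\<exists>\<alpha> \<beta>. \<alpha> * conj \<alpha> + \<beta> * conj \<beta> = 1 \<and> \<alpha> * c + \<beta> * d = 0"
proof (cases "c = 0 \<and> d = 0")
  case True
  then show ?thesis by (intro exI[of _ 1] exI[of _ 0]) auto
next
  case False
  define r where "r = sqrt ((norm c)\<^sup>2 + (norm d)\<^sup>2)"
  have r: "r > 0" "r\<^sup>2 = (norm c)\<^sup>2 + (norm d)\<^sup>2"
    using False by (auto simp: r_def sum_power2_gt_zero_iff)
  let ?\<alpha> = "d / of_real r" and ?\<beta> = "- (c / of_real r)"
  have "(norm ?\<alpha>)\<^sup>2 + (norm ?\<beta>)\<^sup>2 = ((norm c)\<^sup>2 + (norm d)\<^sup>2) / r\<^sup>2"
    using r(1) by (simp add: norm_divide power_divide add_divide_distrib)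
  also have "\<dots> = 1" using r by (metis divide_self less_irrefl zero_less_power2)
  finally have "?\<alpha> * conj ?\<alpha> + ?\<beta> * conj ?\<beta> = 1"
    unfolding mult_conj of_real_add[symmetric] by simp
  then show ?thesis by (intro exI[of _ ?\<alpha>] exI[of _ ?\<beta>]) (auto simp: algebra_simps)
qed

lemma orthonormal_sequence_orthogonal:
  fixes f :: "nat \<Rightarrow> 'h"
  assumes e: "e \<in> bounded_operators" and f: "orthonormal_family UNIV f" "\<And>n. blinfun_apply e (f n) = 0"
    and F: "finite F"
  shows "\<exists>g :: nat \<Rightarrow> 'h. orthonormal_family UNIV g \<and> (\<forall>n. blinfun_apply e (g n) = 0) \<and>
    (\<forall>a\<in>F. \<forall>n. ip (g n) a = 0)"
  using F
proof induction
  case empty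
  then show ?case using f by auto
next
  case (insert a F)
  then obtain g :: "nat \<Rightarrow> 'h" where g: "orthonormal_family UNIV g" "\<And>n. blinfun_apply e (g n) = 0"
    "\<And>a n. a \<in> F \<Longrightarrow> ip (g n) a = 0" by blast
  obtain \<alpha> \<beta> where ab: "\<And>n. \<alpha> n * conj (\<alpha> n) + \<beta> n * conj (\<beta> n) = 1"
    "\<And>n. \<alpha> n * ip (g (2 * n)) a + \<beta> n * ip (g (2 * n + 1)) a = 0"
    using unit_vector_orthogonal[of "ip (g (2 * n)) a" "ip (g (2 * n + 1)) a" for n] by metis
  define h where "h n = scale (\<alpha> n) (g (2 * n)) + scale (\<beta> n) (g (2 * n + 1))" for n
  have "2 * m \<noteq> 2 * n + 1" "2 * n + 1 \<noteq> 2 * m" for m n :: nat by presburger+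
  then have "orthonormal_family UNIV h"
    using ab(1) by (auto simp: orthonormal_family_def h_def ip_add_left ip_add_right ip_scale_left
        ip_scale_right orthonormal_familyD[OF g(1)] mult.commute)
  moreover have "blinfun_apply e (h n) = 0" for n
    by (simp add: h_def blinfun.bilinear_simps bounded_operators_scale[OF e] g)
  moreover have "ip (h n) a = 0" for n
    using ab(2)[of n] by (simp add: h_def ip_add_left ip_scale_left)
  moreover have "ip (h n) a' = 0" if "a' \<in> F" for a' n
    using g(3)[OF that] by (simp add: h_def ip_add_left ip_scale_left)
  ultimately show ?case by (intro exI[of _ h]) auto
qed

end

context hilbert_space_with_basis begin

lemma orthonormal_sequence_separated:
  fixes f :: "nat \<Rightarrow> 'h"
  assumes e: "e \<in> bounded_operators" and f: "orthonormal_family UNIV f" "\<And>n. blinfun_apply e (f n) = 0"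
    and G: "G \<in> bounded_operators"
  obtains x :: "nat \<Rightarrow> 'h" where "orthonormal_family UNIV x" "\<And>n. blinfun_apply e (x n) = 0"
    "\<And>i j. i \<noteq> j \<Longrightarrow> ip (blinfun_apply G (x i)) (x j) = 0"
proof -
  define P where "P y n r \<longleftrightarrow> blinfun_apply e r = 0 \<and> ip r r = 1 \<and> (\<forall>j<n. ip r (y j) = 0 \<and>
    ip r (blinfun_apply G (y j)) = 0 \<and> ip r (blinfun_apply (adj G) (y j)) = 0)"
    for y :: "nat \<Rightarrow> 'h" and n :: nat and r
  have "\<exists>x. \<forall>n. P x n (x n)"
  proof (rule dependent_wellorder_choice)
    show "\<exists>r. P y n r" for y n
    proof -
      let ?F = "y ` {..<n} \<union> (\<lambda>j. blinfun_apply G (y j)) ` {..<n} \<union>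
        (\<lambda>j. blinfun_apply (adj G) (y j)) ` {..<n}"
      have "finite ?F" by simp
      from orthonormal_sequence_orthogonal[OF e f this] obtain g :: "nat \<Rightarrow> 'h" where
        "orthonormal_family UNIV g" "\<forall>n. blinfun_apply e (g n) = 0" "\<forall>a\<in>?F. \<forall>n. ip (g n) a = 0"
        by blast
      then have "P y n (g 0)" by (auto simp: P_def orthonormal_family_def)
      then show ?thesis ..
    qed
  qed (auto simp: P_def)
  then obtain x where x: "\<And>n. P x n (x n)" by blast
  show thesis
  proof
    have less: "ip (x i) (x j) = 0" if "j < i" for i j
      using x[of i] that by (auto simp: P_def)
    have neq: "ip (x i) (x j) = 0" if "i \<noteq> j" for i j
      using less[of i j] less[of j i] ip_sym_0 that by (cases "i < j") auto
    have "ip (x i) (x i) = 1" for i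
      using x[of i] by (simp add: P_def)
    with neq show "orthonormal_family UNIV x"
      by (simp add: orthonormal_family_def)
    show "blinfun_apply e (x n) = 0" for n using x by (auto simp: P_def)
    show "ip (blinfun_apply G (x i)) (x j) = 0" if "i \<noteq> j" for i j
    proof (cases "i < j")
      case True
      then show ?thesis using x[of j] by (auto simp: P_def intro: ip_sym_0)
    next
      case False
      then have "j < i" using that by simp
      then show ?thesis using x[of i] adj_right[OF G] by (auto simp: P_def)
    qed
  qed
qed

lemma corner_isometry_exists:
  fixes x :: "nat \<Rightarrow> 'h"
  assumes B: "countable B" and e: "e \<in> bounded_operators"
    and x: "orthonormal_family UNIV x" "\<And>n. blinfun_apply e (x n) = 0"
  obtains A where "A \<in> corner_isometries e" "\<And>b. b \<in> B \<Longrightarrow> blinfun_apply A b = x (to_nat_on B b)"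
proof -
  have "orthonormal_family B (\<lambda>b. x (to_nat_on B b))"
    using B by (intro orthonormal_family_comp[OF x(1)]) auto
  from isometry_exists[OF this] obtain A where A: "A \<in> bounded_operators"
    "\<And>b. b \<in> B \<Longrightarrow> blinfun_apply A b = x (to_nat_on B b)" by blast
  have "orthonormal_family B (blinfun_apply A)"
    using \<open>orthonormal_family B (\<lambda>b. x (to_nat_on B b))\<close> A(2) by (auto simp: orthonormal_family_def)
  then have "adj A \<odot> A = id_blinfun" by (rule isometry_adj[OF A(1)])
  moreover have "e \<odot> A = 0"
    by (rule operator_eq_on_basis) (use A e x in auto)
  ultimately show thesis using that[of A] A by (auto simp: corner_isometries_def)
qed

lemma rotation_fixes_isometry:
  fixes f :: "nat \<Rightarrow> 'h"
  assumes B: "countable B" and e: "e \<in> projections"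
    and f: "orthonormal_family UNIV f" "\<And>n. blinfun_apply e (f n) = 0"
    and G: "G \<in> corner_unitaries e"
  obtains k A where "k \<in> rotation_group e" "A \<in> corner_isometries e" "k \<odot> G \<odot> A = A"
proof -
  note e' = projectionsD(1)[OF e] and G' = corner_unitariesD[OF G]
  obtain x :: "nat \<Rightarrow> 'h" where x: "orthonormal_family UNIV x" "\<And>n. blinfun_apply e (x n) = 0"
    "\<And>i j. i \<noteq> j \<Longrightarrow> ip (blinfun_apply G (x i)) (x j) = 0"
    using orthonormal_sequence_separated[OF e' f G'(2)] by metis
  have "orthonormal_family UNIV (\<lambda>n. x (2 * n))" "orthonormal_family UNIV (\<lambda>n. x (2 * n + 1))"
    by (auto intro!: orthonormal_family_comp[OF x(1)] inj_onI)
  then obtain A C where A: "A \<in> corner_isometries e"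
      "\<And>b. b \<in> B \<Longrightarrow> blinfun_apply A b = x (2 * to_nat_on B b)"
    and C: "C \<in> corner_isometries e" "\<And>b. b \<in> B \<Longrightarrow> blinfun_apply C b = x (2 * to_nat_on B b + 1)"
    using corner_isometry_exists[OF B e', of "\<lambda>n. x (2 * n)"]
      corner_isometry_exists[OF B e', of "\<lambda>n. x (2 * n + 1)"] x(2) by metis
  note A' = corner_isometriesD[OF A(1)] and C' = corner_isometriesD[OF C(1)]
  have odd: "2 * m \<noteq> 2 * n + 1" for m n :: nat by presburger
  have CA: "adj C \<odot> A = 0"
    by (rule operator_eqI)
       (use A' C' odd in \<open>auto simp: adj_left[symmetric] A(2) C(2) orthonormal_familyD[OF x(1)]\<close>)
  have CG: "adj C \<odot> (G \<odot> A) = 0"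
  proof (rule operator_eqI)
    show "ip (blinfun_apply (adj C \<odot> (G \<odot> A)) b) c = ip (blinfun_apply 0 b) c"
      if "b \<in> B" "c \<in> B" for b c
      using A' C' x(3)[OF odd] that by (simp add: adj_left[symmetric] A(2) C(2))
  qed (use A' C' G' in auto)
  have GC: "adj (G \<odot> A) \<odot> C = 0"
    using adj_comp[of "adj C" "G \<odot> A"] CG A' C' G' by simp
  have GA: "G \<odot> A \<in> corner_isometries e"
    using A' G' by (auto simp: corner_isometries_def intro!: blinfun_eqI)
  note GA' = corner_isometriesD[OF GA]
  obtain k1 where k1: "k1 \<in> rotation_group e" "k1 \<odot> (G \<odot> A) = C"
    using rotation_moves[OF e GA'(1) C'(1) GA'(2) _ C'(2) _ GC GA'(3) C'(3)] by auto
  obtain k2 where k2: "k2 \<in> rotation_group e" "k2 \<odot> C = A"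
    using rotation_moves[OF e C'(1) A'(1) C'(2) _ A'(2) _ CA C'(3) A'(3)] by auto
  have "k2 \<odot> k1 \<odot> G \<odot> A = A"
    using k1(2) k2(2) by (simp add: operator_compose_assoc)
  then show thesis using that rotation_group_comp[OF k2(1) k1(1)] A(1) by blast
qed

text \<open>\<open>G\<close> acts nontrivially only on the range of \<open>q\<close>; a rotation carries that range into the range
  of \<open>C\<close> along \<open>C\<close>.\<close>

lemma rotation_group_absorb:
  assumes e: "e \<in> projections" and G: "G \<in> corner_unitaries e"
    and C: "C \<in> corner_isometries e" and GC: "G \<odot> C = C"
    and dil: "dilation C G \<in> rotation_group e"
  shows "G \<in> rotation_group e"
proof -
  note e' = projectionsD[OF e] and G' = corner_unitariesD[OF G] and C' = corner_isometriesD[OF C]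
  note Ce = corner_adj_0[OF e C'(1,3), THEN compose_eqD]
  define q where "q = id_blinfun - e - C \<odot> adj C"
  have q: "q \<in> bounded_operators" "adj q = q" using e' C' by (auto simp: q_def)
  have qq: "q \<odot> q = q" and qC: "q \<odot> C = 0" and eq: "e \<odot> q = 0" and Cq: "adj C \<odot> q = 0"
    by (auto simp: q_def blinfun.bilinear_simps e' C' Ce intro!: blinfun_eqI)
  obtain k where k: "k \<in> rotation_group e" "k \<odot> q = C \<odot> q"
  proof -
    have "adj (C \<odot> q) \<odot> (C \<odot> q) = q" "C \<odot> q \<odot> q = C \<odot> q" "adj q \<odot> (C \<odot> q) = 0" "e \<odot> (C \<odot> q) = 0"
      using q C' qq compose_eqD[OF qq] compose_eqD[OF qC]
      by (auto intro!: blinfun_eqI)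
    then show thesis
      using rotation_moves[OF e q(1), of "C \<odot> q" q] q C'(1) qq eq that by auto
  qed
  note k' = corner_unitariesD[OF rotation_group_corner_unitary[OF k(1)]]
  have qk: "q \<odot> adj k = q \<odot> adj C"
    using arg_cong[OF k(2), of adj] q k' C' by simp
  have GCx: "blinfun_apply G (blinfun_apply C x) = blinfun_apply C x" for x
    using compose_eqD[OF GC] by simp
  have CG: "blinfun_apply (adj C) (blinfun_apply G x) = blinfun_apply (adj C) x" for x
  proof -
    have "adj G \<odot> C = C"
      by (rule blinfun_eqI) (metis GCx G'(3) blinfun_apply_blinfun_compose)
    then show ?thesis
      using adj_comp[of "adj G" C] G' C' by (metis adj_adj adj_closed blinfun_apply_blinfun_compose)
  qed
  have comm: "blinfun_apply G (blinfun_apply q x) = blinfun_apply q (blinfun_apply G x)" for x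
    by (simp add: q_def blinfun.bilinear_simps G' GCx CG)
  have Gq: "blinfun_apply G x = blinfun_apply G (blinfun_apply q x) + (x - blinfun_apply q x)" for x
    by (simp add: q_def blinfun.bilinear_simps G' GCx)
  have kG: "k \<odot> G \<odot> adj k = dilation C G"
  proof (rule blinfun_eqI)
    fix z
    define w where "w = blinfun_apply (adj k) z"
    have qw: "blinfun_apply q w = blinfun_apply q (blinfun_apply (adj C) z)"
      using arg_cong[OF qk, of "\<lambda>a. blinfun_apply a z"] by (simp add: w_def)
    have kq: "blinfun_apply k (blinfun_apply q y) = blinfun_apply C (blinfun_apply q y)" for y
      using arg_cong[OF k(2), of "\<lambda>a. blinfun_apply a y"] by simp
    have qqx: "blinfun_apply q (blinfun_apply q y) = blinfun_apply q y" for y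
      using compose_eqD[OF qq] .
    have GqwE: "blinfun_apply G (blinfun_apply q w) = blinfun_apply q (blinfun_apply G (blinfun_apply q w))"
      by (metis comm qqx)
    have "blinfun_apply k (blinfun_apply G w) =
        blinfun_apply k (blinfun_apply G (blinfun_apply q w)) + (z - blinfun_apply k (blinfun_apply q w))"
      by (subst Gq) (simp add: blinfun.bilinear_simps w_def k')
    also have "\<dots> = blinfun_apply C (blinfun_apply G (blinfun_apply q w)) + (z - blinfun_apply C (blinfun_apply q w))"
      by (metis GqwE kq)
    also have "\<dots> = blinfun_apply (dilation C G) z"
      using Gq[of "blinfun_apply (adj C) z"]
      by (simp add: dilation_def blinfun.bilinear_simps qw)
    finally show "blinfun_apply (k \<odot> G \<odot> adj k) z = blinfun_apply (dilation C G) z"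
      by (simp add: w_def)
  qed
  have "G = adj k \<odot> dilation C G \<odot> adj (adj k)"
    by (rule blinfun_eqI) (simp add: k' flip: kG)
  then show ?thesis
    using rotation_group_conj[OF dil corner_unitaries_adj[OF rotation_group_corner_unitary[OF k(1)]]]
    by simp
qed

text \<open>The space is the direct sum of the ranges of the isometries \<open>T n\<close>; \<open>t\<close> shifts them, and \<open>Y\<close>
  is the direct sum of copies of \<open>X\<close>.\<close>

lemma swindle_data:
  assumes B: "countable B" "infinite B" and X: "X \<in> unitaries"
  obtains s t Y where "s \<in> bounded_operators" "adj s \<odot> s = id_blinfun"
    "t \<in> bounded_operators" "adj t \<odot> t = id_blinfun" "adj s \<odot> t = 0"
    "s \<odot> adj s + t \<odot> adj t = id_blinfun" "Y \<in> unitaries"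
    "Y = s \<odot> X \<odot> adj s + t \<odot> Y \<odot> adj t"
proof -
  define \<eta> where "\<eta> = to_nat_on B"
  define \<beta> where "\<beta> = from_nat_into B"
  have \<eta>\<beta>: "\<eta> (\<beta> n) = n" "\<beta> n \<in> B" for n
    using B by (auto simp: \<eta>_def \<beta>_def from_nat_into infinite_imp_nonempty)
  have \<beta>\<eta>: "\<beta> (\<eta> b) = b" if "b \<in> B" for b
    using B that by (auto simp: \<eta>_def \<beta>_def)
  define \<theta> where "\<theta> n b = \<beta> (prod_encode (n, \<eta> b))" for n b
  define \<nu> where "\<nu> b = fst (prod_decode (\<eta> b))" for b
  define \<mu> where "\<mu> b = \<beta> (snd (prod_decode (\<eta> b)))" for b
  have \<theta>: "\<theta> n b \<in> B" "\<nu> (\<theta> n b) = n" for n b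
    by (auto simp: \<theta>_def \<nu>_def \<eta>\<beta>)
  have \<mu>: "\<mu> b \<in> B" "b \<in> B \<Longrightarrow> \<mu> (\<theta> n b) = b" "b \<in> B \<Longrightarrow> \<theta> (\<nu> b) (\<mu> b) = b" for n b
    by (auto simp: \<theta>_def \<nu>_def \<mu>_def \<eta>\<beta> \<beta>\<eta>)
  have \<theta>_inj: "\<theta> m b = \<theta> n c \<longleftrightarrow> m = n \<and> b = c" if "b \<in> B" "c \<in> B" for m n b c
    using \<theta>(2) \<mu>(2) that by metis
  have \<nu>\<mu>_inj: "\<nu> b = \<nu> c \<and> \<mu> b = \<mu> c \<longleftrightarrow> b = c" if "b \<in> B" "c \<in> B" for b c
    using \<mu>(3) that by metis
  have "\<exists>T \<in> bounded_operators. \<forall>b\<in>B. blinfun_apply T b = \<theta> n b" for n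
    by (rule isometry_exists) (auto simp: orthonormal_family_def orthonormal \<theta> \<theta>_inj)
  then obtain T where T: "\<And>n. T n \<in> bounded_operators"
    "\<And>n b. b \<in> B \<Longrightarrow> blinfun_apply (T n) b = \<theta> n b"
    by metis
  have cover: "P b" if "b \<in> B" "\<And>n c. c \<in> B \<Longrightarrow> P (blinfun_apply (T n) c)" for P b
    using that \<mu> T(2) by metis
  have TT: "adj (T m) \<odot> T n = (if m = n then id_blinfun else 0)" for m n
  proof (rule operator_eqI)
    fix b c assume bc: "b \<in> B" "c \<in> B"
    then show "ip (blinfun_apply (adj (T m) \<odot> T n) b) c =
        ip (blinfun_apply (if m = n then id_blinfun else 0) b) c"
      using T \<theta> by (auto simp: adj_left[symmetric] orthonormal \<theta>_inj)
  qed (use T in auto)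
  have TTx: "blinfun_apply (adj (T m)) (blinfun_apply (T n) v) = (if m = n then v else 0)" for m n v
    using compose_eqD[OF TT] by simp
  have "orthonormal_family B (\<lambda>b. \<theta> (Suc (\<nu> b)) (\<mu> b))"
    using \<nu>\<mu>_inj by (auto simp: orthonormal_family_def orthonormal \<theta> \<mu>(1) \<theta>_inj)
  from isometry_exists[OF this] obtain t where t: "t \<in> bounded_operators"
    "\<And>b. b \<in> B \<Longrightarrow> blinfun_apply t b = \<theta> (Suc (\<nu> b)) (\<mu> b)" by blast
  have "orthonormal_family B (blinfun_apply t)"
    using \<open>orthonormal_family B (\<lambda>b. \<theta> (Suc (\<nu> b)) (\<mu> b))\<close> t(2) by (auto simp: orthonormal_family_def)
  then have tt: "adj t \<odot> t = id_blinfun" by (rule isometry_adj[OF t(1)])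
  note ttx = compose_eqD[OF tt]
  have "t \<odot> T n = T (Suc n)" for n
    by (rule operator_eq_on_basis) (use T t \<theta> \<mu> in auto)
  then have tT: "blinfun_apply t (blinfun_apply (T n) v) = blinfun_apply (T (Suc n)) v" for n v
    by (metis blinfun_apply_blinfun_compose)
  have "adj (T 0) \<odot> t = 0"
  proof (rule operator_eq_on_basis)
    show "blinfun_apply (adj (T 0) \<odot> t) b = blinfun_apply 0 b" if "b \<in> B" for b
      using that by (rule cover) (simp add: tT TTx)
  qed (use T t in auto)
  then have T0t: "adj (T 0) \<odot> t = 0" "adj t \<odot> T 0 = 0"
    using adj_comp[of "adj (T 0)" t] T(1) t(1) by auto
  have tadj: "blinfun_apply (adj t) (blinfun_apply (T n) v) =
      (case n of 0 \<Rightarrow> 0 | Suc m \<Rightarrow> blinfun_apply (T m) v)" for n v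
    using compose_eqD[OF T0t(2)] ttx by (auto split: nat.split simp flip: tT)
  have split: "T 0 \<odot> adj (T 0) + t \<odot> adj t = id_blinfun"
  proof (rule operator_eq_on_basis)
    show "blinfun_apply (T 0 \<odot> adj (T 0) + t \<odot> adj t) b = blinfun_apply id_blinfun b" if "b \<in> B" for b
      using that by (rule cover) (auto simp: blinfun.bilinear_simps TTx tadj tT split: nat.split)
  qed (use T t in auto)
  have amp: "\<exists>Y \<in> bounded_operators. adj Y \<odot> Y = id_blinfun \<and>
      (\<forall>n v. blinfun_apply Y (blinfun_apply (T n) v) = blinfun_apply (T n) (blinfun_apply Z v))"
    if Z: "Z \<in> unitaries" for Z
  proof -
    note Z' = unitariesD[OF Z]
    have orth: "orthonormal_family B (\<lambda>b. blinfun_apply (T (\<nu> b)) (blinfun_apply Z (\<mu> b)))"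
      unfolding orthonormal_family_def
    proof (intro ballI)
      fix b c assume bc: "b \<in> B" "c \<in> B"
      then show "ip (blinfun_apply (T (\<nu> b)) (blinfun_apply Z (\<mu> b)))
          (blinfun_apply (T (\<nu> c)) (blinfun_apply Z (\<mu> c))) = (if b = c then 1 else 0)"
        using T(1) Z' \<mu>(1) \<nu>\<mu>_inj[OF bc] by (auto simp: adj_left TTx orthonormal)
    qed
    from isometry_exists[OF orth] obtain Y where Y: "Y \<in> bounded_operators"
      "\<And>b. b \<in> B \<Longrightarrow> blinfun_apply Y b = blinfun_apply (T (\<nu> b)) (blinfun_apply Z (\<mu> b))" by blast
    have "Y \<odot> T n = T n \<odot> Z" for n
      by (rule operator_eq_on_basis) (use Y Z' T \<theta> \<mu> in auto)
    then have "\<forall>n v. blinfun_apply Y (blinfun_apply (T n) v) = blinfun_apply (T n) (blinfun_apply Z v)"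
      by (metis blinfun_apply_blinfun_compose)
    moreover have "adj Y \<odot> Y = id_blinfun"
      by (rule isometry_adj[OF Y(1)]) (use orth Y(2) in \<open>auto simp: orthonormal_family_def\<close>)
    ultimately show ?thesis using Y(1) by blast
  qed
  note X' = unitariesD[OF X]
  obtain Y where Y: "Y \<in> bounded_operators" "adj Y \<odot> Y = id_blinfun"
    "\<And>n v. blinfun_apply Y (blinfun_apply (T n) v) = blinfun_apply (T n) (blinfun_apply X v)"
    using amp[OF X] by blast
  obtain Y' where Y': "Y' \<in> bounded_operators"
    "\<And>n v. blinfun_apply Y' (blinfun_apply (T n) v) = blinfun_apply (T n) (blinfun_apply (adj X) v)"
    using amp[OF unitaries_adj[OF X]] by blast
  have YY': "Y \<odot> Y' = id_blinfun"
  proof (rule operator_eq_on_basis)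
    show "blinfun_apply (Y \<odot> Y') b = blinfun_apply id_blinfun b" if "b \<in> B" for b
      using that by (rule cover) (auto simp: Y Y' X')
  qed (use Y Y' in auto)
  have "adj Y = adj Y \<odot> (Y \<odot> Y')" by (simp add: YY')
  also have "\<dots> = Y'" by (simp add: Y(2) flip: operator_compose_assoc)
  finally have "Y \<in> unitaries" using Y YY' by (simp add: unitaries_def)
  moreover have "Y = T 0 \<odot> X \<odot> adj (T 0) + t \<odot> Y \<odot> adj t"
  proof (rule operator_eq_on_basis)
    show "blinfun_apply Y b = blinfun_apply (T 0 \<odot> X \<odot> adj (T 0) + t \<odot> Y \<odot> adj t) b" if "b \<in> B" for b
      using that by (rule cover) (auto simp: blinfun.bilinear_simps Y TTx tadj tT split: nat.split)
  qed (use T t X' Y in auto)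
  ultimately show thesis
    using that[of "T 0" t Y] T(1) TT[of 0 0] t(1) tt T0t(1) split by simp
qed

lemma corner_unitary_in_rotation_group:
  assumes B: "countable B" and e: "e \<in> projections" and inf: "infinite {b \<in> B. blinfun_apply e b = 0}"
    and G: "G \<in> corner_unitaries e"
  shows "G \<in> rotation_group e"
proof -
  have infB: "infinite B" using inf by (metis (no_types, lifting) infinite_super mem_Collect_eq subsetI)
  obtain f :: "nat \<Rightarrow> 'h" where f: "inj f" "range f \<subseteq> {b \<in> B. blinfun_apply e b = 0}"
    using infinite_countable_subset[OF inf] by blast
  have "orthonormal_family UNIV (\<lambda>n. f n)"
    by (rule orthonormal_family_comp[OF orthonormal_family_basis f(1)]) (use f(2) in auto)
  moreover have "blinfun_apply e (f n) = 0" for n using f(2) by auto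
  ultimately obtain k A where k: "k \<in> rotation_group e" and A: "A \<in> corner_isometries e"
    and kGA: "k \<odot> G \<odot> A = A"
    using rotation_fixes_isometry[OF B e _ _ G] by blast
  note k' = rotation_group_corner_unitary[OF k]
  define H where "H = k \<odot> G"
  have H: "H \<in> corner_unitaries e" unfolding H_def by (intro corner_unitaries_comp k' G)
  obtain s t Y where st: "s \<in> bounded_operators" "adj s \<odot> s = id_blinfun"
    "t \<in> bounded_operators" "adj t \<odot> t = id_blinfun" "adj s \<odot> t = 0"
    "s \<odot> adj s + t \<odot> adj t = id_blinfun" "Y \<in> unitaries"
    "Y = s \<odot> H \<odot> adj s + t \<odot> Y \<odot> adj t"
    using swindle_data[OF B infB corner_unitariesD(1)[OF H]] by metis
  have "H \<odot> (A \<odot> t \<odot> s) = A \<odot> t \<odot> s"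
    using kGA by (simp add: H_def flip: operator_compose_assoc)
  moreover have "A \<odot> t \<odot> s \<in> corner_isometries e"
    by (intro corner_isometries_comp A st)
  moreover have "dilation (A \<odot> t \<odot> s) H \<in> rotation_group e"
    by (rule swindle[OF e A st(1-6) corner_unitariesD(1)[OF H] st(7,8)])
  ultimately have "H \<in> rotation_group e"
    using rotation_group_absorb[OF e H] by blast
  moreover have "G = adj k \<odot> H"
    using corner_unitariesD[OF k'] by (auto intro!: blinfun_eqI simp: H_def)
  ultimately show ?thesis
    using rotation_group_comp rotation_group_adj[OF k] by blast
qed

lemma path_component_offdiagonal:
  assumes B: "countable B" and e: "e \<in> projections" and inf: "infinite {b \<in> B. blinfun_apply e b = 0}"
    and u: "u \<in> offdiagonal_symmetries e" and v: "v \<in> offdiagonal_symmetries e"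
  shows "path_component (offdiagonal_symmetries e) u v"
proof -
  note e' = projectionsD[OF e] and u' = offdiagonal_symmetriesD[OF u] and v' = offdiagonal_symmetriesD[OF v]
  define w where "w = e + v \<odot> u \<odot> (id_blinfun - e)"
  have adjw: "adj w = e + (id_blinfun - e) \<odot> u \<odot> v"
    using e' u' v' by (simp add: w_def operator_compose_assoc)
  have w: "w \<in> unitaries"
  proof (rule unitariesI)
    show "w \<in> bounded_operators" using e' u' v' by (simp add: w_def)
  qed (simp_all add: adjw, simp_all add: w_def blinfun.bilinear_simps e' u' v')
  then have "w \<in> corner_unitaries e"
    by (rule corner_unitariesI) (simp_all add: w_def blinfun.bilinear_simps e' u' v')
  then have "w \<in> rotation_group e"
    by (rule corner_unitary_in_rotation_group[OF B e inf])
  moreover have "w \<odot> u \<odot> adj w = v"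
    by (rule blinfun_eqI) (simp add: adjw, simp add: w_def blinfun.bilinear_simps e' u' v')
  ultimately show ?thesis
    using path_component_rotation_group[OF _ u] by metis
qed


definition zero_diagonal_symmetries :: "('h \<Rightarrow>\<^sub>L 'h) set" where
  "zero_diagonal_symmetries = {x \<in> symmetries. \<forall>b\<in>B. ip (blinfun_apply x b) b = 0}"

lemma diagonal_projection_cases:
  assumes e: "e \<in> projections" "e \<in> diagonal_operators" and b: "b \<in> B"
  shows "blinfun_apply e b = b \<or> blinfun_apply e b = 0"
proof -
  define l where "l = ip (blinfun_apply e b) b"
  have "blinfun_apply e b - scale l b = 0"
    by (rule basis_orthogonal_zero)
       (use e b in \<open>auto simp: l_def diagonal_operators_def ip_diff_left ip_scale_left orthonormal\<close>)
  then have eb: "blinfun_apply e b = scale l b" by simp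
  have "scale (l * l) b = scale l b"
    using projectionsD(3)[OF e(1), of b] bounded_operators_scale[OF projectionsD(1)[OF e(1)]]
    by (simp add: eb del: scale_cancel_right)
  then have "ip (scale (l * l) b) b = ip (scale l b) b" by (rule arg_cong)
  then have "l * l = l" using b by (simp add: ip_scale_left orthonormal)
  then have "l = 0 \<or> l = 1" by auto
  then show ?thesis using eb by auto
qed

lemma offdiagonal_zero_diagonal:
  assumes e: "e \<in> projections" "e \<in> diagonal_operators" and b: "b \<in> B"
    and z: "z \<odot> e + e \<odot> z = z"
  shows "ip (blinfun_apply z b) b = 0"
proof -
  have "blinfun_apply z b = blinfun_apply z (blinfun_apply e b) + blinfun_apply e (blinfun_apply z b)"
    using arg_cong[OF z, of "\<lambda>a. blinfun_apply a b"] by (simp add: blinfun.bilinear_simps)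
  then have "ip (blinfun_apply z b) b =
      ip (blinfun_apply z (blinfun_apply e b)) b + ip (blinfun_apply z b) (blinfun_apply e b)"
    using projectionsD[OF e(1)] by (metis adj_right ip_add_left)
  then show ?thesis
    using diagonal_projection_cases[OF e b] by auto
qed

lemma offdiagonal_symmetries_subset:
  assumes "e \<in> projections" "e \<in> diagonal_operators"
  shows "offdiagonal_symmetries e \<subseteq> zero_diagonal_symmetries"
  using offdiagonal_zero_diagonal[OF assms]
  by (auto simp: offdiagonal_symmetries_def zero_diagonal_symmetries_def)

section \<open>Square roots\<close>

definition bicommutant :: "('h \<Rightarrow>\<^sub>L 'h) \<Rightarrow> ('h \<Rightarrow>\<^sub>L 'h) set" where
  "bicommutant h = {s \<in> bounded_operators. is_adjoint s s \<and>
     (\<forall>c \<in> bounded_operators. c \<odot> h = h \<odot> c \<longrightarrow> c \<odot> s = s \<odot> c)}"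

lemma bicommutantD:
  assumes "s \<in> bicommutant h"
  shows "s \<in> bounded_operators" "adj s = s"
    "\<And>c. c \<in> bounded_operators \<Longrightarrow> c \<odot> h = h \<odot> c \<Longrightarrow> c \<odot> s = s \<odot> c"
  using assms by (auto simp: bicommutant_def intro: adj_eqI)

lemma bicommutantI:
  assumes "s \<in> bounded_operators" "adj s = s"
    "\<And>c. c \<in> bounded_operators \<Longrightarrow> c \<odot> h = h \<odot> c \<Longrightarrow> c \<odot> s = s \<odot> c"
  shows "s \<in> bicommutant h"
  using assms adj_right[OF assms(1)] by (auto simp: bicommutant_def is_adjoint_def)

lemma closed_bicommutant: "closed (bicommutant h)"
proof -
  have "bicommutant h = bounded_operators \<inter> {s. \<forall>x y. ip (blinfun_apply s x) y = ip x (blinfun_apply s y)} \<inter>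
      (\<Inter>c \<in> {c \<in> bounded_operators. c \<odot> h = h \<odot> c}. {s. c \<odot> s = s \<odot> c})"
    by (auto simp: bicommutant_def is_adjoint_def)
  also have "closed \<dots>"
    by (intro closed_Int closed_INT ballI closed_bounded_operators closed_Collect_all
        closed_Collect_eq continuous_intros)
  finally show ?thesis .
qed

lemma bicommutant_commute:
  assumes "h \<in> bounded_operators" "s \<in> bicommutant h" "m \<in> bicommutant h"
  shows "s \<odot> m = m \<odot> s"
  using bicommutantD[OF assms(2)] bicommutantD[OF assms(3)] assms(1) by metis

lemma bicommutant_closure:
  assumes h: "h \<in> bounded_operators" and s: "s \<in> bicommutant h" and m: "m \<in> bicommutant h"
  shows "s + m \<in> bicommutant h" "r *\<^sub>R s \<in> bicommutant h" "s \<odot> m \<in> bicommutant h"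
proof -
  note s' = bicommutantD[OF s] and m' = bicommutantD[OF m]
  show "s + m \<in> bicommutant h" "r *\<^sub>R s \<in> bicommutant h"
    by (rule bicommutantI; use s' m' in \<open>simp add: operator_compose_distribs\<close>)+
  show "s \<odot> m \<in> bicommutant h"
  proof (rule bicommutantI)
    fix c assume c: "c \<in> bounded_operators" "c \<odot> h = h \<odot> c"
    show "c \<odot> (s \<odot> m) = s \<odot> m \<odot> c"
      using s'(3)[OF c] m'(3)[OF c] by (metis operator_compose_assoc)
  qed (use s' m' bicommutant_commute[OF h s m] in auto)
qed

lemma id_bicommutant: "id_blinfun \<in> bicommutant h"
  by (rule bicommutantI) auto

lemma self_bicommutant: "h \<in> bounded_operators \<Longrightarrow> adj h = h \<Longrightarrow> h \<in> bicommutant h"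
  by (rule bicommutantI) auto

text \<open>If \<open>2 s = h + s\<^sup>2\<close> then \<open>(1 - s)\<^sup>2 = 1 - h\<close>.\<close>

lemma sqrt_fixed_point:
  assumes h: "h \<in> bounded_operators" "adj h = h" and k: "norm h \<le> k"
    and \<rho>: "0 \<le> \<rho>" "\<rho> < 1" "k + \<rho>\<^sup>2 = 2 * \<rho>"
  shows "\<exists>s \<in> bicommutant h. norm s \<le> \<rho> \<and> s = (1/2) *\<^sub>R (h + s \<odot> s)"
proof -
  let ?S = "bicommutant h \<inter> cball 0 \<rho>"
  let ?f = "\<lambda>s. (1/2) *\<^sub>R (h + s \<odot> s)"
  have "\<exists>!s\<in>?S. ?f s = s"
  proof (rule Banach_fix)
    show "complete ?S"
      by (intro closed_Int closed_bicommutant closed_cball complete_eq_closed[THEN iffD2])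
    show "?S \<noteq> {}"
      using \<rho>(1) bicommutant_closure(2)[OF h(1) id_bicommutant id_bicommutant, of 0] by auto
    show "?f ` ?S \<subseteq> ?S"
    proof
      fix y assume "y \<in> ?f ` ?S"
      then obtain s where s: "s \<in> bicommutant h" "norm s \<le> \<rho>" "y = ?f s" by auto
      have "norm (h + s \<odot> s) \<le> norm h + norm (s \<odot> s)" by (rule norm_triangle_ineq)
      also have "norm (s \<odot> s) \<le> norm s * norm s" by (rule norm_blinfun_compose)
      also have "norm s * norm s \<le> \<rho> * \<rho>" using s(2) \<rho>(1) by (intro mult_mono) auto
      finally have "norm y \<le> \<rho>"
        using k \<rho>(3) s(3) by (simp add: power2_eq_square)
      then show "y \<in> ?S"
        using s bicommutant_closure[OF h(1)] self_bicommutant[OF h] by simp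
    qed
    fix s m assume sm: "s \<in> ?S" "m \<in> ?S"
    have "?f s - ?f m = (1/2) *\<^sub>R (s \<odot> (s - m) + (s - m) \<odot> m)"
      by (rule blinfun_eqI) (simp add: blinfun.bilinear_simps scaleR_right_distrib scaleR_right_diff_distrib)
    then have "dist (?f s) (?f m) = (1/2) * norm (s \<odot> (s - m) + (s - m) \<odot> m)"
      by (simp add: dist_norm)
    also have "norm (s \<odot> (s - m) + (s - m) \<odot> m) \<le> norm s * norm (s - m) + norm (s - m) * norm m"
      by (intro norm_triangle_le add_mono norm_blinfun_compose)
    also have "\<dots> \<le> \<rho> * norm (s - m) + norm (s - m) * \<rho>"
      using sm \<rho>(1) by (intro add_mono mult_mono) auto
    finally show "dist (?f s) (?f m) \<le> \<rho> * dist s m" by (simp add: dist_norm)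
  qed (use \<rho> in auto)
  then obtain s where "s \<in> ?S" "?f s = s" by blast
  then show ?thesis by (intro bexI[of _ s]) auto
qed

lemma sqrt_fixed_point_lipschitz:
  fixes s s' h h' :: "'h \<Rightarrow>\<^sub>L 'h"
  assumes "norm s \<le> \<rho>" "s = (1/2) *\<^sub>R (h + s \<odot> s)" "norm s' \<le> \<rho>" "s' = (1/2) *\<^sub>R (h' + s' \<odot> s')"
  shows "(1 - \<rho>) * norm (s - s') \<le> norm (h - h') / 2"
proof -
  have "s - s' = (1/2) *\<^sub>R ((h - h') + (s \<odot> (s - s') + (s - s') \<odot> s'))"
    by (subst assms(2), subst assms(4))
       (simp add: operator_compose_distribs scaleR_right_diff_distrib scaleR_right_distrib)
  then have "norm (s - s') = (1/2) * norm ((h - h') + (s \<odot> (s - s') + (s - s') \<odot> s'))"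
    by (metis abs_of_nonneg half_gt_zero_iff less_eq_real_def norm_scaleR zero_less_one)
  also have "norm ((h - h') + (s \<odot> (s - s') + (s - s') \<odot> s')) \<le>
      norm (h - h') + (norm s * norm (s - s') + norm (s - s') * norm s')"
    by (intro norm_triangle_le add_mono norm_blinfun_compose order_refl)
  also have "\<dots> \<le> norm (h - h') + (\<rho> * norm (s - s') + norm (s - s') * \<rho>)"
    using assms by (intro add_mono mult_right_mono mult_left_mono order_refl) auto
  finally show ?thesis by (simp add: algebra_simps)
qed

lemma neumann_inverse:
  assumes h: "h \<in> bounded_operators" and s: "s \<in> bicommutant h" "norm s \<le> \<rho>" "0 \<le> \<rho>" "\<rho> < 1"
  shows "\<exists>m \<in> bicommutant h. m = id_blinfun + s \<odot> m"
proof -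
  let ?f = "\<lambda>m. id_blinfun + s \<odot> m"
  have "\<exists>!m\<in>bicommutant h. ?f m = m"
  proof (rule Banach_fix)
    show "complete (bicommutant h)"
      using closed_bicommutant by (simp add: complete_eq_closed)
    show "bicommutant h \<noteq> {}" using id_bicommutant by blast
    show "?f ` bicommutant h \<subseteq> bicommutant h"
      by (auto intro!: bicommutant_closure[OF h] id_bicommutant s(1))
    fix m m' assume "m \<in> bicommutant h" "m' \<in> bicommutant h"
    have "dist (?f m) (?f m') = norm (s \<odot> (m - m'))"
      by (simp add: dist_norm operator_compose_distribs)
    also have "\<dots> \<le> norm s * norm (m - m')" by (rule norm_blinfun_compose)
    also have "\<dots> \<le> \<rho> * dist m m'" using s by (auto simp: dist_norm intro: mult_right_mono)
    finally show "dist (?f m) (?f m') \<le> \<rho> * dist m m'" .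
  qed (use s in auto)
  then show ?thesis by metis
qed

lemma block_diagonal_norm:
  assumes e: "e \<in> projections" and x: "x \<in> bounded_operators"
    and r: "norm (e \<odot> x \<odot> e) \<le> r" "norm ((id_blinfun - e) \<odot> x \<odot> (id_blinfun - e)) \<le> r"
  shows "norm (e \<odot> x \<odot> e + (id_blinfun - e) \<odot> x \<odot> (id_blinfun - e)) \<le> r"
proof (rule norm_blinfun_bound)
  note e' = projectionsD[OF e]
  define f where "f = id_blinfun - e"
  show r0: "0 \<le> r" using r(1) norm_ge_zero order_trans by blast
  fix v
  have orth: "ip (blinfun_apply e p) (blinfun_apply f q) = 0" for p q
    using e' by (simp add: adj_right f_def blinfun.bilinear_simps)
  have block: "(norm (blinfun_apply (g \<odot> x \<odot> g) v))\<^sup>2 \<le> (r * norm (blinfun_apply g v))\<^sup>2"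
    if "norm (g \<odot> x \<odot> g) \<le> r" "\<And>w. blinfun_apply g (blinfun_apply g w) = blinfun_apply g w" for g
  proof -
    have "norm (blinfun_apply (g \<odot> x \<odot> g) v) = norm (blinfun_apply (g \<odot> x \<odot> g) (blinfun_apply g v))"
      using that(2) by simp
    also have "\<dots> \<le> norm (g \<odot> x \<odot> g) * norm (blinfun_apply g v)" by (rule norm_blinfun)
    also have "\<dots> \<le> r * norm (blinfun_apply g v)" using that(1) by (intro mult_right_mono) auto
    finally show ?thesis by (intro power_mono) auto
  qed
  have ff: "blinfun_apply f (blinfun_apply f w) = blinfun_apply f w" for w
    by (simp add: f_def blinfun.bilinear_simps e')
  have "(norm (blinfun_apply (e \<odot> x \<odot> e + f \<odot> x \<odot> f) v))\<^sup>2 =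
      (norm (blinfun_apply (e \<odot> x \<odot> e) v))\<^sup>2 + (norm (blinfun_apply (f \<odot> x \<odot> f) v))\<^sup>2"
    by (simp add: blinfun.bilinear_simps orth pythagoras)
  also have "\<dots> \<le> (r * norm (blinfun_apply e v))\<^sup>2 + (r * norm (blinfun_apply f v))\<^sup>2"
    by (intro add_mono block e' ff r[folded f_def])
  also have "\<dots> = r\<^sup>2 * ((norm (blinfun_apply e v))\<^sup>2 + (norm (blinfun_apply f v))\<^sup>2)"
    by (simp add: power_mult_distrib distrib_left)
  also have "(norm (blinfun_apply e v))\<^sup>2 + (norm (blinfun_apply f v))\<^sup>2 = (norm v)\<^sup>2"
    by (subst pythagoras[symmetric]) (auto simp: orth, simp add: f_def blinfun.bilinear_simps)
  finally have "(norm (blinfun_apply (e \<odot> x \<odot> e + f \<odot> x \<odot> f) v))\<^sup>2 \<le> (r * norm v)\<^sup>2"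
    by (simp add: power_mult_distrib)
  then show "norm (blinfun_apply (e \<odot> x \<odot> e + (id_blinfun - e) \<odot> x \<odot> (id_blinfun - e)) v) \<le> r * norm v"
    unfolding f_def by (rule power2_le_imp_le) (use r0 in auto)
qed

text \<open>With \<open>x = \<alpha> + \<beta>\<close> split into block diagonal and block off-diagonal part, the path is
  \<open>t \<alpha> + sqrt (1 - t\<^sup>2 \<alpha>\<^sup>2) u\<close> where \<open>u = sqrt (1 - \<alpha>\<^sup>2)\<^sup>-\<^sup>1 \<beta>\<close>; \<open>S t\<close> stands for
  \<open>1 - sqrt (1 - t\<^sup>2 \<alpha>\<^sup>2)\<close>.\<close>

lemma path_component_paved:
  assumes e: "e \<in> projections" "e \<in> diagonal_operators" and x: "x \<in> zero_diagonal_symmetries"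
    and r: "norm (e \<odot> x \<odot> e) < 1" "norm ((id_blinfun - e) \<odot> x \<odot> (id_blinfun - e)) < 1"
  shows "\<exists>u \<in> offdiagonal_symmetries e. path_component zero_diagonal_symmetries u x"
proof -
  note e' = projectionsD[OF e(1)]
  have "x \<in> symmetries" and xdiag: "\<And>b. b \<in> B \<Longrightarrow> ip (blinfun_apply x b) b = 0"
    using x by (auto simp: zero_diagonal_symmetries_def)
  note x' = symmetriesD[OF this(1)]
  define \<alpha> where "\<alpha> = e \<odot> x \<odot> e + (id_blinfun - e) \<odot> x \<odot> (id_blinfun - e)"
  define \<beta> where "\<beta> = x - \<alpha>"
  have \<alpha>: "\<alpha> \<in> bounded_operators" "adj \<alpha> = \<alpha>"
    using e' x' by (simp_all add: \<alpha>_def operator_compose_assoc)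
  have \<beta>: "\<beta> \<in> bounded_operators" "adj \<beta> = \<beta>"
    using \<alpha> x' by (simp_all add: \<beta>_def)
  have \<alpha>e: "\<alpha> \<odot> e = e \<odot> \<alpha>"
    by (rule blinfun_eqI) (simp add: \<alpha>_def blinfun.bilinear_simps e')
  have \<beta>e: "\<beta> \<odot> e + e \<odot> \<beta> = \<beta>"
    by (rule blinfun_eqI) (simp add: \<beta>_def \<alpha>_def blinfun.bilinear_simps e')
  have sq: "\<beta> \<odot> \<beta> = id_blinfun - \<alpha> \<odot> \<alpha>"
    by (rule blinfun_eqI) (simp add: \<beta>_def \<alpha>_def blinfun.bilinear_simps e' x' algebra_simps)
  have anti: "\<beta> \<odot> \<alpha> = - (\<alpha> \<odot> \<beta>)"
    by (rule blinfun_eqI) (simp add: \<beta>_def \<alpha>_def blinfun.bilinear_simps e' x' algebra_simps)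
  define r where "r = max (norm (e \<odot> x \<odot> e)) (norm ((id_blinfun - e) \<odot> x \<odot> (id_blinfun - e)))"
  have r: "norm \<alpha> \<le> r" "0 \<le> r" "r < 1"
    using block_diagonal_norm[OF e(1) x'(1), of r] assms(4,5)
    by (auto simp: r_def \<alpha>_def le_max_iff_disj)
  define h where "h = \<alpha> \<odot> \<alpha>"
  have h: "h \<in> bounded_operators" "adj h = h" using \<alpha> by (auto simp: h_def)
  have "norm h \<le> norm \<alpha> * norm \<alpha>" unfolding h_def by (rule norm_blinfun_compose)
  also have "\<dots> \<le> r\<^sup>2" using r by (auto simp: power2_eq_square intro!: mult_mono)
  finally have normh: "norm h \<le> r\<^sup>2" .
  have r2: "r\<^sup>2 < 1" using r by (simp add: power_less_one_iff)
  define \<rho> where "\<rho> = 1 - sqrt (1 - r\<^sup>2)"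
  have \<rho>: "0 \<le> \<rho>" "\<rho> < 1" "r\<^sup>2 + \<rho>\<^sup>2 = 2 * \<rho>"
    using r2 r(2) by (auto simp: \<rho>_def power2_diff)
  have ex: "\<exists>s. s \<in> bicommutant (t\<^sup>2 *\<^sub>R h) \<and> norm s \<le> \<rho> \<and> s = (1/2) *\<^sub>R (t\<^sup>2 *\<^sub>R h + s \<odot> s)"
    if "t \<in> {0..1}" for t :: real
  proof -
    have "norm (t\<^sup>2 *\<^sub>R h) \<le> 1 * norm h"
      using that by (simp add: power_le_one mult_left_le_one_le)
    then have "norm (t\<^sup>2 *\<^sub>R h) \<le> r\<^sup>2" using normh by linarith
    then show ?thesis
      using sqrt_fixed_point[of "t\<^sup>2 *\<^sub>R h", OF _ _ _ \<rho>] h by auto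
  qed
  then obtain S where S: "\<And>t. t \<in> {0..1} \<Longrightarrow> S t \<in> bicommutant (t\<^sup>2 *\<^sub>R h)"
    "\<And>t. t \<in> {0..1} \<Longrightarrow> norm (S t) \<le> \<rho>"
    "\<And>t. t \<in> {0..1} \<Longrightarrow> S t = (1/2) *\<^sub>R (t\<^sup>2 *\<^sub>R h + S t \<odot> S t)"
    by metis
  have comm: "c \<odot> S t = S t \<odot> c" if "t \<in> {0..1}" "c \<in> bounded_operators" "c \<odot> h = h \<odot> c" for t c
    by (rule bicommutantD(3)[OF S(1)]) (use that in \<open>simp_all add: operator_compose_distribs\<close>)
  have SBO: "S t \<in> bounded_operators" "adj (S t) = S t" if "t \<in> {0..1}" for t
    using bicommutantD[OF S(1)[OF that]] by auto
  have "S 1 \<in> bicommutant h" using S(1)[of 1] by simp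
  from neumann_inverse[OF h(1) this S(2) \<rho>(1,2)] obtain m where
    m: "m \<in> bicommutant h" "m = id_blinfun + S 1 \<odot> m" by auto
  note m' = bicommutantD[OF m(1)]
  have \<alpha>h: "\<alpha> \<odot> h = h \<odot> \<alpha>" by (simp add: h_def operator_compose_assoc)
  have eh: "e \<odot> h = h \<odot> e" using \<alpha>e by (metis h_def operator_compose_assoc)
  have \<beta>h: "\<beta> \<odot> h = h \<odot> \<beta>"
    by (rule blinfun_eqI)
       (use compose_eqD[OF anti] in \<open>simp add: h_def blinfun.bilinear_simps\<close>)
  have pt_anti: "blinfun_apply \<beta> (blinfun_apply \<alpha> v) = - blinfun_apply \<alpha> (blinfun_apply \<beta> v)" for v
    using compose_eqD[OF anti] by (simp add: blinfun.bilinear_simps)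
  have m\<alpha>: "blinfun_apply \<alpha> (blinfun_apply m v) = blinfun_apply m (blinfun_apply \<alpha> v)" for v
    using m'(3)[OF \<alpha>(1) \<alpha>h] by (metis blinfun_apply_blinfun_compose)
  have m\<beta>: "blinfun_apply \<beta> (blinfun_apply m v) = blinfun_apply m (blinfun_apply \<beta> v)" for v
    using m'(3)[OF \<beta>(1) \<beta>h] by (metis blinfun_apply_blinfun_compose)
  have me: "blinfun_apply e (blinfun_apply m v) = blinfun_apply m (blinfun_apply e v)" for v
    using m'(3)[OF e'(1) eh] by (metis blinfun_apply_blinfun_compose)
  have hS: "h \<odot> S t = S t \<odot> h" if "t \<in> {0..1}" for t
    using comm[OF that h(1)] by simp
  have S_simps: "blinfun_apply \<alpha> (blinfun_apply (S t) v) = blinfun_apply (S t) (blinfun_apply \<alpha> v)"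
    "blinfun_apply \<beta> (blinfun_apply (S t) v) = blinfun_apply (S t) (blinfun_apply \<beta> v)"
    "blinfun_apply e (blinfun_apply (S t) v) = blinfun_apply (S t) (blinfun_apply e v)"
    "blinfun_apply m (blinfun_apply (S t) v) = blinfun_apply (S t) (blinfun_apply m v)"
    if "t \<in> {0..1}" for t v
    using comm[OF that \<alpha>(1) \<alpha>h] comm[OF that \<beta>(1) \<beta>h] comm[OF that e'(1) eh]
      m'(3)[OF SBO(1)[OF that] hS[OF that, symmetric]]
    by (metis blinfun_apply_blinfun_compose)+
  define u where "u = m \<odot> \<beta>"
  have u: "u \<in> bounded_operators" "adj u = u"
    using m' \<beta> m'(3)[OF \<beta>(1) \<beta>h] by (auto simp: u_def)
  have S1: "blinfun_apply (S 1) (blinfun_apply m v) = blinfun_apply m v - v" for v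
    using arg_cong[OF m(2), of "\<lambda>a. blinfun_apply a v"]
    by (simp add: blinfun.bilinear_simps eq_diff_eq add.commute)
  have Ssq: "blinfun_apply (S t) (blinfun_apply (S t) v) =
      2 *\<^sub>R blinfun_apply (S t) v - t\<^sup>2 *\<^sub>R blinfun_apply \<alpha> (blinfun_apply \<alpha> v)" if "t \<in> {0..1}" for t v
  proof -
    have "2 *\<^sub>R blinfun_apply (S t) v = t\<^sup>2 *\<^sub>R blinfun_apply h v + blinfun_apply (S t) (blinfun_apply (S t) v)"
      by (subst S(3)[OF that]) (simp add: blinfun.bilinear_simps)
    then show ?thesis by (simp add: h_def)
  qed
  have uu: "blinfun_apply u (blinfun_apply u v) = v" for v
  proof -
    have "blinfun_apply u (blinfun_apply u v) =
        blinfun_apply m (blinfun_apply m (v - blinfun_apply \<alpha> (blinfun_apply \<alpha> v)))"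
      using compose_eqD[OF sq] by (simp add: u_def m\<beta> blinfun.bilinear_simps)
    also have "v - blinfun_apply \<alpha> (blinfun_apply \<alpha> v) =
        v - 2 *\<^sub>R blinfun_apply (S 1) v + blinfun_apply (S 1) (blinfun_apply (S 1) v)"
      using Ssq[of 1] by simp
    also have "blinfun_apply m (blinfun_apply m \<dots>) = v"
      by (simp add: blinfun.bilinear_simps S_simps[of 1] S1 scaleR_2)
    finally show ?thesis .
  qed
  have ue: "u \<odot> e + e \<odot> u = u"
    by (rule blinfun_eqI)
       (use arg_cong[OF \<beta>e, of "blinfun_apply"] in
         \<open>simp add: u_def me blinfun.bilinear_simps fun_eq_iff flip: blinfun.add_right\<close>)
  have u_off: "u \<in> offdiagonal_symmetries e"
    using u uu ue by (auto simp: offdiagonal_symmetries_def symmetries_def intro!: blinfun_eqI)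
  have u\<alpha>: "blinfun_apply u (blinfun_apply \<alpha> v) = - blinfun_apply \<alpha> (blinfun_apply u v)" for v
    by (simp add: u_def pt_anti m\<alpha> blinfun.bilinear_simps)
  have uS: "blinfun_apply u (blinfun_apply (S t) v) = blinfun_apply (S t) (blinfun_apply u v)"
    if "t \<in> {0..1}" for t v
    using S_simps[OF that] by (simp add: u_def)
  define R where "R t = t *\<^sub>R \<alpha> + (id_blinfun - S t) \<odot> u" for t
  have R: "R t \<in> zero_diagonal_symmetries" if t: "t \<in> {0..1}" for t
  proof -
    have "(id_blinfun - S t) \<odot> u = u \<odot> (id_blinfun - S t)"
      using uS[OF t] by (auto intro!: blinfun_eqI simp: blinfun.bilinear_simps)
    then have "adj (R t) = R t"
      using SBO[OF t] u \<alpha> by (simp add: R_def)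
    moreover have "R t \<in> bounded_operators" using SBO[OF t] u \<alpha> by (simp add: R_def)
    moreover have "R t \<odot> R t = id_blinfun"
      by (rule blinfun_eqI)
         (simp add: R_def blinfun.bilinear_simps uu u\<alpha> uS[OF t] S_simps[OF t] Ssq[OF t]
           scaleR_right_distrib scaleR_right_diff_distrib scaleR_2 power2_eq_square algebra_simps)
    moreover have "ip (blinfun_apply (R t) b) b = 0" if b: "b \<in> B" for b
    proof -
      have "((id_blinfun - S t) \<odot> u) \<odot> e + e \<odot> ((id_blinfun - S t) \<odot> u) = (id_blinfun - S t) \<odot> u"
        by (rule blinfun_eqI)
           (simp add: blinfun.bilinear_simps S_simps[OF t] offdiagonal_symmetriesD(5)[OF u_off])
      then have "ip (blinfun_apply ((id_blinfun - S t) \<odot> u) b) b = 0"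
        by (rule offdiagonal_zero_diagonal[OF e b])
      moreover have "ip (blinfun_apply \<beta> b) b = 0"
        by (rule offdiagonal_zero_diagonal[OF e b \<beta>e])
      ultimately show ?thesis
        using xdiag[OF b] by (simp add: R_def \<beta>_def blinfun.bilinear_simps ip_add_left ip_diff_left ip_scaleR_left)
    qed
    ultimately show ?thesis by (simp add: zero_diagonal_symmetries_def symmetries_def)
  qed
  have "continuous_on {0..1} S"
  proof (rule lipschitz_on_continuous_on)
    show "(1 / (1 - \<rho>))-lipschitz_on {0..1} S"
    proof (rule lipschitz_onI)
      fix t t' :: real assume t: "t \<in> {0..1}" "t' \<in> {0..1}"
      have "t\<^sup>2 *\<^sub>R h - t'\<^sup>2 *\<^sub>R h = ((t + t') * (t - t')) *\<^sub>R h"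
        by (simp add: power2_eq_square algebra_simps)
      then have "norm (t\<^sup>2 *\<^sub>R h - t'\<^sup>2 *\<^sub>R h) = (\<bar>t + t'\<bar> * norm h) * \<bar>t - t'\<bar>"
        by (simp add: abs_mult)
      also have "\<dots> \<le> (2 * 1) * \<bar>t - t'\<bar>"
        using t normh r2 by (intro mult_mono) auto
      finally have "norm (t\<^sup>2 *\<^sub>R h - t'\<^sup>2 *\<^sub>R h) / 2 \<le> \<bar>t - t'\<bar>" by simp
      with sqrt_fixed_point_lipschitz[OF S(2,3)[OF t(1)] S(2,3)[OF t(2)]]
      have "(1 - \<rho>) * norm (S t - S t') \<le> \<bar>t - t'\<bar>" by (rule order_trans)
      then show "dist (S t) (S t') \<le> 1 / (1 - \<rho>) * dist t t'"
        using \<rho>(2) by (simp add: dist_norm field_simps)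
    qed (use \<rho> in auto)
  qed
  then have "path R"
    unfolding path_def R_def by (intro continuous_intros)
  moreover have "path_image R \<subseteq> zero_diagonal_symmetries"
    using R by (auto simp: path_image_def)
  moreover have "pathstart R = u"
  proof -
    have "(0::real)\<^sup>2 *\<^sub>R h = 0" by simp
    note S0 = S(3)[of 0, unfolded this]
    have "(1 - \<rho>) * norm (S 0 - 0) \<le> norm (0 - 0 :: 'h \<Rightarrow>\<^sub>L 'h) / 2"
      by (rule sqrt_fixed_point_lipschitz[OF S(2) S0]) (use \<rho> in auto)
    then have "S 0 = 0" using \<rho>(2) by (simp add: mult_le_0_iff)
    then show ?thesis by (simp add: pathstart_def R_def)
  qed
  moreover have "pathfinish R = x"
    by (rule blinfun_eqI)
       (simp add: pathfinish_def R_def blinfun.bilinear_simps u_def S1, simp add: \<beta>_def blinfun.bilinear_simps)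
  ultimately show ?thesis using u_off unfolding path_component_def by blast
qed

end

section \<open>Changing the diagonal projection\<close>

lemma infinite_split:
  assumes "infinite S"
  obtains T where "T \<subseteq> S" "infinite T" "infinite (S - T)"
proof -
  obtain f :: "nat \<Rightarrow> 'a" where f: "inj f" "range f \<subseteq> S"
    using infinite_countable_subset[OF assms] by blast
  let ?T = "range (\<lambda>n. f (2 * n))"
  have "infinite ?T" "infinite (range (\<lambda>n. f (2 * n + 1)))"
    by (auto intro!: range_inj_infinite injI dest!: injD[OF f(1)])
  moreover have "range (\<lambda>n. f (2 * n + 1)) \<subseteq> S - ?T"
  proof -
    have "2 * m + 1 \<noteq> 2 * n" for m n :: nat by presburger
    then show ?thesis using f by (auto simp: inj_eq)
  qed
  ultimately show thesis using that[of ?T] f(2) infinite_super by blast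
qed

lemma common_infinite_split:
  fixes E E' B :: "'a set"
  assumes E: "\<And>i. infinite {b \<in> B. (b \<in> E) = i}" and E': "\<And>i. infinite {b \<in> B. (b \<in> E') = i}"
  shows "\<exists>W. (\<forall>i j. infinite {b \<in> B. (b \<in> E) = i \<and> (b \<in> W) = j}) \<and>
    (\<forall>i j. infinite {b \<in> B. (b \<in> W) = i \<and> (b \<in> E') = j})"
proof -
  define X where "X i j = {b \<in> B. (b \<in> E) = i \<and> (b \<in> E') = j}" for i j
  have "\<exists>T \<subseteq> X i j. infinite (X i j) \<longrightarrow> infinite T \<and> infinite (X i j - T)" for i j
  proof (cases "infinite (X i j)")
    case True
    then show ?thesis by (rule infinite_split) blast
  qed blast
  then obtain T where T: "\<And>i j. T i j \<subseteq> X i j"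
    "\<And>i j. infinite (X i j) \<Longrightarrow> infinite (T i j)" "\<And>i j. infinite (X i j) \<Longrightarrow> infinite (X i j - T i j)"
    by metis
  define W where "W = (\<Union>i j. T i j)"
  have XT: "X i j \<inter> W = T i j" for i j
    using T(1) unfolding W_def X_def by blast
  have XW: "infinite {b \<in> X i j. (b \<in> W) = k}" if "infinite (X i j)" for i j k
  proof (cases k)
    case True
    then have "{b \<in> X i j. (b \<in> W) = k} = T i j" using XT[of i j] by auto
    then show ?thesis using T(2)[OF that] by simp
  next
    case False
    then have "{b \<in> X i j. (b \<in> W) = k} = X i j - T i j" using XT[of i j] by auto
    then show ?thesis using T(3)[OF that] by simp
  qed
  show ?thesis
  proof (intro exI[of _ W] conjI allI)
    fix i k
    have "{b \<in> B. (b \<in> E) = i} = X i True \<union> X i False" by (auto simp: X_def)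
    then obtain j where "infinite (X i j)"
      using E finite_Un by metis
    moreover have "{b \<in> X i j. (b \<in> W) = k} \<subseteq> {b \<in> B. (b \<in> E) = i \<and> (b \<in> W) = k}"
      by (auto simp: X_def)
    ultimately show "infinite {b \<in> B. (b \<in> E) = i \<and> (b \<in> W) = k}"
      using XW[of i j k] infinite_super by blast
  next
    fix i k
    have "{b \<in> B. (b \<in> E') = k} = X True k \<union> X False k" by (auto simp: X_def)
    then obtain j where "infinite (X j k)"
      using E' finite_Un by metis
    moreover have "{b \<in> X j k. (b \<in> W) = i} \<subseteq> {b \<in> B. (b \<in> W) = i \<and> (b \<in> E') = k}"
      by (auto simp: X_def)
    ultimately show "infinite {b \<in> B. (b \<in> W) = i \<and> (b \<in> E') = k}"
      using XW[of j k i] infinite_super by blast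
  qed
qed

lemma crossing_involution:
  assumes "countable B" and inf: "\<And>i j. infinite {b \<in> B. (b \<in> E) = i \<and> (b \<in> W) = j}"
  shows "\<exists>\<pi>. \<forall>b\<in>B. \<pi> b \<in> B \<and> \<pi> (\<pi> b) = b \<and> (\<pi> b \<in> E \<longleftrightarrow> b \<notin> E) \<and> (\<pi> b \<in> W \<longleftrightarrow> b \<notin> W)"
proof -
  define c where "c i j = {b \<in> B. (b \<in> E) = i \<and> (b \<in> W) = j}" for i j
  have c: "infinite (c i j)" "countable (c i j)" "c i j \<noteq> {}" for i j
    using inf[of i j] infinite_imp_nonempty[OF inf, of i j] assms(1)
    by (simp_all add: c_def countable_subset)
  define \<pi> where
    "\<pi> b = from_nat_into (c (b \<notin> E) (b \<notin> W)) (to_nat_on (c (b \<in> E) (b \<in> W)) b)" for b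
  have "\<pi> b \<in> c (b \<notin> E) (b \<notin> W)" for b
    unfolding \<pi>_def by (rule from_nat_into[OF c(3)])
  then have \<pi>: "\<pi> b \<in> B" "\<pi> b \<in> E \<longleftrightarrow> b \<notin> E" "\<pi> b \<in> W \<longleftrightarrow> b \<notin> W" for b
    by (auto simp: c_def)
  have "\<pi> (\<pi> b) = b" if "b \<in> B" for b
  proof -
    have "b \<in> c (b \<in> E) (b \<in> W)" using that by (simp add: c_def)
    then show ?thesis
      unfolding \<pi>_def[of "\<pi> b"] \<pi> by (simp add: \<pi>_def c)
  qed
  with \<pi> show ?thesis by blast
qed

context hilbert_space_with_basis begin

lemma diagonal_projection_exists:
  "\<exists>e \<in> projections \<inter> diagonal_operators. \<forall>b\<in>B. blinfun_apply e b = (if b \<in> A then b else 0)"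
proof -
  have "norm (if b \<in> A then 1 else 0 :: 'k) \<le> 1" for b by simp
  then obtain e where e: "e \<in> bounded_operators"
    "\<And>b. b \<in> B \<Longrightarrow> blinfun_apply e b = scale (if b \<in> A then 1 else 0) b"
    using diagonal_operator_exists[of "\<lambda>b. if b \<in> A then 1 else 0" 1] by blast
  have "adj e = e"
    by (rule operator_eqI) (use e in \<open>auto simp: adj_left[symmetric] orthonormal\<close>)
  moreover have "e \<odot> e = e"
    by (rule operator_eq_on_basis) (use e in auto)
  moreover have "e \<in> diagonal_operators"
    using e by (auto simp: diagonal_operators_def orthonormal)
  ultimately show ?thesis
    using e adj_right[OF e(1)] by (intro bexI[of _ e]) (auto simp: projections_def is_adjoint_def)
qed

lemma permutation_symmetry_exists:
  assumes \<pi>: "\<And>b. b \<in> B \<Longrightarrow> \<pi> b \<in> B" "\<And>b. b \<in> B \<Longrightarrow> \<pi> (\<pi> b) = b"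
  shows "\<exists>x \<in> symmetries. \<forall>b\<in>B. blinfun_apply x b = \<pi> b"
proof -
  have "inj_on \<pi> B" using \<pi>(2) by (metis inj_onI)
  then have "orthonormal_family B (\<lambda>b. \<pi> b)"
    by (rule orthonormal_family_comp[OF orthonormal_family_basis]) (use \<pi> in auto)
  from isometry_exists[OF this] obtain x where x: "x \<in> bounded_operators"
    "\<And>b. b \<in> B \<Longrightarrow> blinfun_apply x b = \<pi> b" by blast
  have "adj x = x"
  proof (rule operator_eqI)
    fix b c assume bc: "b \<in> B" "c \<in> B"
    have "b = \<pi> c \<longleftrightarrow> \<pi> b = c" using bc \<pi> by metis
    then show "ip (blinfun_apply (adj x) b) c = ip (blinfun_apply x b) c"
      using x bc \<pi>(1) by (simp add: adj_left[symmetric] orthonormal)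
  qed (use x in auto)
  moreover have "x \<odot> x = id_blinfun"
    by (rule operator_eq_on_basis) (use x \<pi> in auto)
  ultimately show ?thesis using x by (auto simp: symmetries_def)
qed

lemma permutation_offdiagonal:
  assumes e: "e \<in> bounded_operators" "\<And>b. b \<in> B \<Longrightarrow> blinfun_apply e b = (if b \<in> E then b else 0)"
    and x: "x \<in> symmetries" "\<And>b. b \<in> B \<Longrightarrow> blinfun_apply x b = \<pi> b"
    and \<pi>: "\<And>b. b \<in> B \<Longrightarrow> \<pi> b \<in> B" "\<And>b. b \<in> B \<Longrightarrow> \<pi> b \<in> E \<longleftrightarrow> b \<notin> E"
  shows "x \<in> offdiagonal_symmetries e"
proof -
  have "x \<odot> e + e \<odot> x = x"
    by (rule operator_eq_on_basis)
       (use e x \<pi> symmetriesD(1)[OF x(1)] in \<open>auto simp: blinfun.bilinear_simps\<close>)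
  then show ?thesis using x(1) by (simp add: offdiagonal_symmetries_def)
qed

lemma offdiagonal_complement:
  "u \<in> offdiagonal_symmetries e \<Longrightarrow> u \<in> offdiagonal_symmetries (id_blinfun - e)"
  by (auto simp: offdiagonal_symmetries_def operator_compose_distribs algebra_simps)

lemma complement_projection:
  assumes "e \<in> projections" "e \<in> diagonal_operators"
  shows "id_blinfun - e \<in> projections" "id_blinfun - e \<in> diagonal_operators"
  using assms
  by (auto simp: projections_def diagonal_operators_def is_adjoint_def blinfun.bilinear_simps
      ip_diff_left ip_diff_right orthonormal operator_compose_distribs)

text \<open>\<open>u\<close> embeds the range of \<open>e\<close> isometrically into its kernel; counting Hilbert-Schmidt norms
  compares the ranks.\<close>

lemma infinite_kernel:
  assumes B: "infinite B" and e: "e \<in> projections" "e \<in> diagonal_operators"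
    and u: "u \<in> offdiagonal_symmetries e"
  shows "infinite {b \<in> B. blinfun_apply e b = 0}"
proof
  define Q where "Q = {b \<in> B. blinfun_apply e b = 0}"
  define P where "P = {b \<in> B. blinfun_apply e b = b}"
  note u' = offdiagonal_symmetriesD[OF u] and e' = projectionsD[OF e(1)]
  assume "finite {b \<in> B. blinfun_apply e b = 0}"
  then have Q: "finite Q" "Q \<subseteq> B" by (auto simp: Q_def)
  have "B = P \<union> Q" using diagonal_projection_cases[OF e] by (auto simp: P_def Q_def)
  then have "infinite P" using B Q by auto
  then obtain F where F: "finite F" "card F = Suc (card Q)" "F \<subseteq> P"
    using infinite_arbitrarily_large by blast
  have norm_u: "(norm (blinfun_apply u b))\<^sup>2 = 1" if "b \<in> B" for b
  proof -
    have "(of_real ((norm (blinfun_apply u b))\<^sup>2) :: 'k) = ip b b"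
      unfolding ip_self[symmetric] by (simp only: adj_right[OF u'(2)] u'(3,4))
    then show ?thesis using orthonormal[OF that that] by (metis of_real_eq_1_iff)
  qed
  have exp: "(norm (blinfun_apply u b))\<^sup>2 = (\<Sum>c\<in>Q. (norm (ip (blinfun_apply u b) c))\<^sup>2)" if b: "b \<in> P" for b
  proof -
    have eb: "blinfun_apply e b = b" using b by (simp add: P_def)
    have orth: "ip (blinfun_apply u b) c = 0" if "c \<in> P" for c
    proof -
      have "ip (blinfun_apply u b) c = ip (blinfun_apply u b) (blinfun_apply e c)"
        using that by (simp add: P_def)
      also have "\<dots> = ip (blinfun_apply e (blinfun_apply u b)) c"
        by (simp only: adj_left[OF e'(1)] e'(2))
      finally show ?thesis by (simp add: u'(5) eb)
    qed
    have "blinfun_apply u b - (\<Sum>c\<in>Q. scale (ip (blinfun_apply u b) c) c) = 0"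
    proof (rule basis_orthogonal_zero)
      fix d assume d: "d \<in> B"
      have "(\<Sum>c\<in>Q. ip (blinfun_apply u b) c * ip c d) =
          (\<Sum>c\<in>Q. if c = d then ip (blinfun_apply u b) d else 0)"
        using Q d by (intro sum.cong refl) (auto simp: orthonormal subset_iff)
      also have "\<dots> = ip (blinfun_apply u b) d"
        using Q d \<open>B = P \<union> Q\<close> orth by auto
      finally show "ip (blinfun_apply u b - (\<Sum>c\<in>Q. scale (ip (blinfun_apply u b) c) c)) d = 0"
        by (simp add: ip_diff_left ip_sum_left ip_scale_left)
    qed
    then show ?thesis using norm_lincomb[OF Q, of "\<lambda>c. ip (blinfun_apply u b) c"] by simp
  qed
  have "real (card F) = (\<Sum>b\<in>F. (norm (blinfun_apply u b))\<^sup>2)"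
    using norm_u F(3) by (simp add: P_def subset_iff)
  also have "\<dots> = (\<Sum>b\<in>F. \<Sum>c\<in>Q. (norm (ip (blinfun_apply u b) c))\<^sup>2)"
    using exp F(3) by (intro sum.cong refl) auto
  also have "\<dots> = (\<Sum>c\<in>Q. \<Sum>b\<in>F. (norm (ip (blinfun_apply u b) c))\<^sup>2)" by (rule sum.swap)
  also have "\<dots> = (\<Sum>c\<in>Q. \<Sum>b\<in>F. (norm (ip (blinfun_apply u c) b))\<^sup>2)"
  proof (intro sum.cong refl)
    fix b c
    have "ip (blinfun_apply u b) c = ip b (blinfun_apply u c)"
      by (simp only: adj_right[OF u'(2)] u'(3))
    also have "\<dots> = conj (ip (blinfun_apply u c) b)" by (rule ip_commute)
    finally show "(norm (ip (blinfun_apply u b) c))\<^sup>2 = (norm (ip (blinfun_apply u c) b))\<^sup>2" by simp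
  qed
  also have "\<dots> \<le> (\<Sum>c\<in>Q. (norm (blinfun_apply u c))\<^sup>2)"
    using F by (intro sum_mono bessel) (auto simp: P_def)
  also have "\<dots> = real (card Q)" using norm_u Q by (simp add: subset_iff)
  finally show False using F(2) by simp
qed

lemma path_component_offdiagonal_link:
  assumes B: "countable B" "infinite B"
    and e: "e \<in> projections" "e \<in> diagonal_operators" and u: "u \<in> offdiagonal_symmetries e"
    and f: "f \<in> projections" "f \<in> diagonal_operators" and v: "v \<in> offdiagonal_symmetries f"
  shows "path_component zero_diagonal_symmetries u v"
proof -
  define E where "E = {b \<in> B. blinfun_apply e b = b}"
  define F where "F = {b \<in> B. blinfun_apply f b = b}"
  have nz: "0 \<notin> B" using orthonormal[of 0 0] by auto
  have eE: "blinfun_apply e b = (if b \<in> E then b else 0)" if "b \<in> B" for b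
    using diagonal_projection_cases[OF e that] that by (auto simp: E_def)
  have fF: "blinfun_apply f b = (if b \<in> F then b else 0)" if "b \<in> B" for b
    using diagonal_projection_cases[OF f that] that by (auto simp: F_def)
  note kernels = infinite_kernel[OF B(2) e u] infinite_kernel[OF B(2) f v]
    infinite_kernel[OF B(2) complement_projection[OF e] offdiagonal_complement[OF u]]
    infinite_kernel[OF B(2) complement_projection[OF f] offdiagonal_complement[OF v]]
  have "{b \<in> B. blinfun_apply (id_blinfun - e) b = 0} = {b \<in> B. (b \<in> E) = True}"
    "{b \<in> B. blinfun_apply (id_blinfun - f) b = 0} = {b \<in> B. (b \<in> F) = True}"
    "{b \<in> B. blinfun_apply e b = 0} = {b \<in> B. (b \<in> E) = False}"
    "{b \<in> B. blinfun_apply f b = 0} = {b \<in> B. (b \<in> F) = False}"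
    using eE fF nz by (auto simp: blinfun.bilinear_simps split: if_splits)
  then have EF: "infinite {b \<in> B. (b \<in> E) = i}" "infinite {b \<in> B. (b \<in> F) = i}" for i
    using kernels by (cases i; simp)+
  obtain W where W: "\<And>i j. infinite {b \<in> B. (b \<in> E) = i \<and> (b \<in> W) = j}"
    "\<And>i j. infinite {b \<in> B. (b \<in> W) = i \<and> (b \<in> F) = j}"
    using common_infinite_split[OF EF] by blast
  obtain w where w: "w \<in> projections" "w \<in> diagonal_operators"
    "\<And>b. b \<in> B \<Longrightarrow> blinfun_apply w b = (if b \<in> W then b else 0)"
    using diagonal_projection_exists[of W] by auto
  have "infinite {b \<in> B. blinfun_apply w b = 0}"
  proof -
    have "{b \<in> B. (b \<in> E) = True \<and> (b \<in> W) = False} \<subseteq> {b \<in> B. blinfun_apply w b = 0}"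
      using w(3) by auto
    then show ?thesis using W(1) infinite_super by blast
  qed
  note inf = kernels(1) this kernels(2)
  obtain \<pi> where \<pi>: "\<And>b. b \<in> B \<Longrightarrow> \<pi> b \<in> B" "\<And>b. b \<in> B \<Longrightarrow> \<pi> (\<pi> b) = b"
    "\<And>b. b \<in> B \<Longrightarrow> \<pi> b \<in> E \<longleftrightarrow> b \<notin> E" "\<And>b. b \<in> B \<Longrightarrow> \<pi> b \<in> W \<longleftrightarrow> b \<notin> W"
    using crossing_involution[OF B(1) W(1)] by blast
  obtain \<sigma> where \<sigma>: "\<And>b. b \<in> B \<Longrightarrow> \<sigma> b \<in> B" "\<And>b. b \<in> B \<Longrightarrow> \<sigma> (\<sigma> b) = b"
    "\<And>b. b \<in> B \<Longrightarrow> \<sigma> b \<in> W \<longleftrightarrow> b \<notin> W" "\<And>b. b \<in> B \<Longrightarrow> \<sigma> b \<in> F \<longleftrightarrow> b \<notin> F"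
    using crossing_involution[OF B(1) W(2)] by blast
  obtain x where x: "x \<in> symmetries" "\<And>b. b \<in> B \<Longrightarrow> blinfun_apply x b = \<pi> b"
    using permutation_symmetry_exists[OF \<pi>(1,2)] by blast
  obtain y where y: "y \<in> symmetries" "\<And>b. b \<in> B \<Longrightarrow> blinfun_apply y b = \<sigma> b"
    using permutation_symmetry_exists[OF \<sigma>(1,2)] by blast
  note BO = projectionsD(1)
  note mono = path_component_of_subset[OF offdiagonal_symmetries_subset]
  have "path_component zero_diagonal_symmetries u x"
    by (rule mono[OF e path_component_offdiagonal[OF B(1) e(1) inf(1) u
          permutation_offdiagonal[OF BO[OF e(1)] eE x \<pi>(1,3)]]])
  also have "path_component zero_diagonal_symmetries x y"
    by (rule mono[OF w(1,2) path_component_offdiagonal[OF B(1) w(1) inf(2)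
          permutation_offdiagonal[OF BO[OF w(1)] w(3) x \<pi>(1,4)]
          permutation_offdiagonal[OF BO[OF w(1)] w(3) y \<sigma>(1,3)]]])
  also (path_component_trans) have "path_component zero_diagonal_symmetries y v"
    by (rule mono[OF f path_component_offdiagonal[OF B(1) f(1) inf(3)
          permutation_offdiagonal[OF BO[OF f(1)] fF y \<sigma>(1,4)] v]])
  finally (path_component_trans) show ?thesis .
qed

lemma half_diagonal_symmetry:
  assumes "p \<in> half_diagonal_projections"
  shows "2 *\<^sub>R p - id_blinfun \<in> zero_diagonal_symmetries"
proof -
  have p: "p \<in> projections" and d: "diagonal_part p = (1/2) *\<^sub>R id_blinfun"
    using assms by (auto simp: half_diagonal_projections_def)
  note p' = projectionsD[OF p]
  have "2 *\<^sub>R p - id_blinfun \<in> symmetries"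
    using p' by (auto simp: symmetries_def blinfun.bilinear_simps scaleR_right_diff_distrib
        simp flip: scaleR_left_diff_distrib intro!: blinfun_eqI)
  moreover have "ip (blinfun_apply (2 *\<^sub>R p - id_blinfun) b) b = 0" if b: "b \<in> B" for b
  proof -
    have "ip (blinfun_apply p b) b = (1/2) *\<^sub>R ip b b"
      using diagonal_part(2)[OF b, of p] unfolding d by (simp add: blinfun.bilinear_simps ip_scaleR_left)
    then show ?thesis by (simp add: blinfun.bilinear_simps ip_diff_left ip_scaleR_left)
  qed
  ultimately show ?thesis by (simp add: zero_diagonal_symmetries_def)
qed

lemma symmetry_half_diagonal:
  assumes "x \<in> zero_diagonal_symmetries"
  shows "(1/2) *\<^sub>R (id_blinfun + x) \<in> half_diagonal_projections"
proof -
  have x: "x \<in> symmetries" "\<And>b. b \<in> B \<Longrightarrow> ip (blinfun_apply x b) b = 0"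
    using assms by (auto simp: zero_diagonal_symmetries_def)
  note x' = symmetriesD[OF x(1)]
  let ?p = "(1/2) *\<^sub>R (id_blinfun + x)"
  have "adj ?p = ?p" "?p \<in> bounded_operators" using x' by simp_all
  then have "is_adjoint ?p ?p" using adj_right[of ?p] by (simp add: is_adjoint_def)
  moreover have "?p \<odot> ?p = ?p"
    by (rule blinfun_eqI)
       (simp add: blinfun.bilinear_simps x' scaleR_right_distrib algebra_simps flip: scaleR_left_distrib)
  ultimately have "?p \<in> projections" using \<open>?p \<in> bounded_operators\<close> by (simp add: projections_def)
  moreover have "diagonal_part ?p = (1/2) *\<^sub>R id_blinfun"
  proof (rule operator_eqI)
    show "diagonal_part ?p \<in> bounded_operators"
      using diagonal_part(1) by (simp add: diagonal_operators_def)
    show "ip (blinfun_apply (diagonal_part ?p) b) c = ip (blinfun_apply ((1/2) *\<^sub>R id_blinfun) b) c"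
      if "b \<in> B" "c \<in> B" for b c
    proof (cases "b = c")
      case True
      then show ?thesis using that diagonal_part(2)[OF that(1), of ?p] x(2)
        by (simp add: blinfun.bilinear_simps ip_add_left ip_scaleR_left)
    next
      case False
      then show ?thesis using that diagonal_part(1)[of ?p]
        by (simp add: diagonal_operators_def blinfun.bilinear_simps ip_scaleR_left orthonormal)
    qed
  qed simp
  ultimately show ?thesis by (simp add: half_diagonal_projections_def)
qed

lemma path_component_half_diagonal:
  assumes "path_component zero_diagonal_symmetries (2 *\<^sub>R p - id_blinfun) (2 *\<^sub>R q - id_blinfun)"
  shows "path_component half_diagonal_projections p q"
proof -
  let ?h = "\<lambda>x. (1/2) *\<^sub>R (id_blinfun + x)"
  obtain g where g: "path g" "path_image g \<subseteq> zero_diagonal_symmetries"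
    "pathstart g = 2 *\<^sub>R p - id_blinfun" "pathfinish g = 2 *\<^sub>R q - id_blinfun"
    using assms unfolding path_component_def by blast
  have "path (?h \<circ> g)"
    by (intro path_continuous_image[OF g(1)] continuous_intros)
  moreover have "path_image (?h \<circ> g) \<subseteq> half_diagonal_projections"
    using g(2) symmetry_half_diagonal by (auto simp: path_image_compose)
  moreover have "pathstart (?h \<circ> g) = p" "pathfinish (?h \<circ> g) = q"
    using g(3,4) by (auto simp: pathstart_compose pathfinish_compose)
  ultimately show ?thesis unfolding path_component_def by blast
qed

end

context separable_infinite_dimensional_hilbert_space begin

lemma infinite_basis: "infinite B"
proof
  assume fin: "finite B"
  have "x \<in> span B" for x
  proof -
    have "x - (\<Sum>b\<in>B. scale (ip x b) b) = 0"
    proof (rule basis_orthogonal_zero)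
      fix d assume d: "d \<in> B"
      have "(\<Sum>b\<in>B. ip x b * ip b d) = (\<Sum>b\<in>B. if b = d then ip x d else 0)"
        using d by (intro sum.cong refl) (auto simp: orthonormal)
      then show "ip (x - (\<Sum>b\<in>B. scale (ip x b) b)) d = 0"
        using fin d by (simp add: ip_diff_left ip_sum_left ip_scale_left)
    qed
    then have x: "x = (\<Sum>b\<in>B. scale (ip x b) b)" by simp
    show ?thesis by (subst x) (intro span_sum span_scale span_base)
  qed
  then show False using infinite_dimensional fin by blast
qed

lemma countable_basis: "countable B"
proof -
  obtain C :: "'h set" where C: "countable C" "closure C = UNIV"
    using separable unfolding separable_space_def by auto
  have "\<exists>c\<in>C. dist c b < 1/2" for b
    using C(2) closure_approachable[of b C] by (metis UNIV_I half_gt_zero_iff zero_less_one)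
  then obtain c where c: "\<And>b. c b \<in> C" "\<And>b. dist (c b) b < 1/2" by metis
  have "inj_on c B"
  proof (rule inj_onI, rule ccontr)
    fix a b assume ab: "a \<in> B" "b \<in> B" "c a = c b" "a \<noteq> b"
    have "dist a b < 1"
      using c(2)[of a] c(2)[of b] ab(3) dist_triangle2[of a b "c b"] by (simp add: dist_commute)
    moreover have "1 \<le> norm (a - b)"
    proof -
      have "norm (ip (a - b) a) \<le> norm (a - b)" by (rule norm_ip_basis_le[OF ab(1)])
      then show ?thesis using ab by (simp add: ip_diff_left orthonormal)
    qed
    ultimately show False by (simp add: dist_norm)
  qed
  then show ?thesis
    using C(1) c(1) by (metis countable_image_inj_on countable_subset image_subsetI)
qed

theorem path_component_two_pavable:
  assumes p: "p \<in> half_diagonal_projections" "two_pavable (2 *\<^sub>R p - id_blinfun)"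
    and q: "q \<in> half_diagonal_projections" "two_pavable (2 *\<^sub>R q - id_blinfun)"
  shows "path_component half_diagonal_projections p q"
proof -
  let ?x = "2 *\<^sub>R p - id_blinfun" and ?y = "2 *\<^sub>R q - id_blinfun"
  obtain e u where e: "e \<in> projections" "e \<in> diagonal_operators"
    and u: "u \<in> offdiagonal_symmetries e" "path_component zero_diagonal_symmetries u ?x"
    using p(2) path_component_paved[OF _ _ half_diagonal_symmetry[OF p(1)]]
    unfolding two_pavable_def by blast
  obtain f v where f: "f \<in> projections" "f \<in> diagonal_operators"
    and v: "v \<in> offdiagonal_symmetries f" "path_component zero_diagonal_symmetries v ?y"
    using q(2) path_component_paved[OF _ _ half_diagonal_symmetry[OF q(1)]]
    unfolding two_pavable_def by blast
  have "path_component zero_diagonal_symmetries u v"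
    by (rule path_component_offdiagonal_link[OF countable_basis infinite_basis e u(1) f v(1)])
  then have "path_component zero_diagonal_symmetries ?x ?y"
    using u(2) v(2) path_component_sym path_component_trans by blast
  then show ?thesis by (rule path_component_half_diagonal)
qed

end

theorem theorem8p1:
  fixes scaleC :: "complex \<Rightarrow> 'h::banach \<Rightarrow> 'h"
    and cinner :: "'h \<Rightarrow> 'h \<Rightarrow> complex"
    and B :: "'h set"
    and B' :: "'g::{real_inner, banach} set"
  shows
    "(separable_infinite_dimensional_hilbert_space scaleC cnj cinner B \<longrightarrow>
        (\<forall>p \<in> hilbert_space_with_basis.half_diagonal_projections scaleC cinner B.
         \<forall>q \<in> hilbert_space_with_basis.half_diagonal_projections scaleC cinner B.
           hilbert_space_with_basis.two_pavable scaleC cinner B (2 *\<^sub>R p - id_blinfun) \<longrightarrow>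
           hilbert_space_with_basis.two_pavable scaleC cinner B (2 *\<^sub>R q - id_blinfun) \<longrightarrow>
           path_component (hilbert_space_with_basis.half_diagonal_projections scaleC cinner B) p q))
     \<and>
     (separable_infinite_dimensional_hilbert_space scaleR (\<lambda>r::real. r) inner B' \<longrightarrow>
        (\<forall>p \<in> hilbert_space_with_basis.half_diagonal_projections scaleR inner B'.
         \<forall>q \<in> hilbert_space_with_basis.half_diagonal_projections scaleR inner B'.
           hilbert_space_with_basis.two_pavable scaleR inner B' (2 *\<^sub>R p - id_blinfun) \<longrightarrow>
           hilbert_space_with_basis.two_pavable scaleR inner B' (2 *\<^sub>R q - id_blinfun) \<longrightarrow>
           path_component (hilbert_space_with_basis.half_diagonal_projections scaleR inner B') p q))"
  using separable_infinite_dimensional_hilbert_space.path_component_two_pavable[of scaleC cnj cinner B]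
    separable_infinite_dimensional_hilbert_space.path_component_two_pavable[of scaleR "\<lambda>r::real. r" inner B']
  by blast

end
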